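(* Let $\Omega$ be a proper countable $D$-set with a unary predicate $P$ such that $P\neq\emptyset$ and $P\neq\Omega$. Then $\Omega$ is $P$-homogeneous if and only if all of the following hold: (1) $\Omega$ is dense; (2) any two node splittings of $P$ (viewed as a $D$-set with the induced relation) have the same number of sectors (either a natural number greater than $2$ or $\aleph_0$), and likewise any two node splittings of $\Omega\setminus P$ have the same number of sectors; (3) one of the following holds: (a) for every infinite sector $\Sigma$ of every splitting of $\Omega$, $\Sigma\cap P\neq\emptyset$ and $\Sigma\setminus P\neq\emptyset$; (b) $\{P,\Omega\setminus P\}$ is a true edge splitting of $\Omega$; (c) $|P|=1$ or $|\Omega\setminus P|=1$.
   Context: A $D$-set is a set $\Omega$ with a quaternary relation $D$, written $D(wx;yz)$, such that for all $w,x,y,z\in\Omega$: (D1) $D(wx;yz)\to (D(xw;yz)\wedge D(yz;wx))$; (D2) $D(wx;yz)\to\neg D(wy;xz)$; (D3) $D(wx;yz)\to\forall v\,(D(vx;yz)\vee D(wx;yv))$; (D4) $(w\neq y\wedge x\neq y)\to D(wx;yy)$. It is proper if $|\Omega|\ge 3$ and whenever $w,x,y$ are pairwise distinct there is $z\neq y$ with $D(wx;yz)$. It is dense if $|\Omega|\ge 2$ and $D(wx;yz)$ implies there is $v$ with $D(vx;yz)\wedge D(wv;yz)\wedge D(wx;vz)\wedge D(wx;yv)$. A splitting of a $D$-set $X$ is a partition of $X$ into at least two parts (sectors) such that (i) if $a,b$ lie in a part $\Sigma$ and $c,d\in X\setminus\Sigma$ then $D(ab;cd)$, and (ii) if $a,b,c,d$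 lie in four distinct parts then $\neg D(ab;cd)$. A node splitting has more than two sectors; an edge splitting has exactly two; a true edge splitting is an edge splitting which has no refinement that is a node splitting and none of whose sectors is a singleton. The structure $(\Omega;D,P)$ is $P$-homogeneous if whenever $A,B$ are finite substructures with $A\cap P$, $A\setminus P$, $B\cap P$, $B\setminus P$ all nonempty, every isomorphism $A\to B$ (preserving $D$ and $P$) extends to an automorphism of $(\Omega;D,P)$. *)

theory Defs
  imports "HOL-Library.Disjoint_Sets" "HOL-Library.Equipollence" "HOL-Library.Countable_Set"
begin

text \<open>
  The relation written \<open>D(wx;yz)\<close> on paper is \<open>D w x y z\<close>. The ground set \<open>X\<close> is an explicit
  carrier, and all axioms only concern the restriction of \<open>D\<close> to \<open>X\<close>; the structure induced on
  a subset \<open>Y\<close> of \<open>X\<close> is therefore simply the pair of \<open>Y\<close> and \<open>D\<close>.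
\<close>

definition D_set :: "'a set \<Rightarrow> ('a \<Rightarrow> 'a \<Rightarrow> 'a \<Rightarrow> 'a \<Rightarrow> bool) \<Rightarrow> bool" where
  "D_set X D \<longleftrightarrow>
     (\<forall>w\<in>X. \<forall>x\<in>X. \<forall>y\<in>X. \<forall>z\<in>X.
        (D w x y z \<longrightarrow> D x w y z \<and> D y z w x) \<and>
        (D w x y z \<longrightarrow> \<not> D w y x z) \<and>
        (D w x y z \<longrightarrow> (\<forall>v\<in>X. D v x y z \<or> D w x y v)) \<and>
        (w \<noteq> y \<and> x \<noteq> y \<longrightarrow> D w x y y))"

definition D_proper :: "'a set \<Rightarrow> ('a \<Rightarrow> 'a \<Rightarrow> 'a \<Rightarrow> 'a \<Rightarrow> bool) \<Rightarrow> bool" where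
  "D_proper X D \<longleftrightarrow>
     (infinite X \<or> 3 \<le> card X) \<and>
     (\<forall>w\<in>X. \<forall>x\<in>X. \<forall>y\<in>X. w \<noteq> x \<and> w \<noteq> y \<and> x \<noteq> y \<longrightarrow> (\<exists>z\<in>X. z \<noteq> y \<and> D w x y z))"

definition D_dense :: "'a set \<Rightarrow> ('a \<Rightarrow> 'a \<Rightarrow> 'a \<Rightarrow> 'a \<Rightarrow> bool) \<Rightarrow> bool" where
  "D_dense X D \<longleftrightarrow>
     (infinite X \<or> 2 \<le> card X) \<and>
     (\<forall>w\<in>X. \<forall>x\<in>X. \<forall>y\<in>X. \<forall>z\<in>X. D w x y z \<longrightarrow>
        (\<exists>v\<in>X. D v x y z \<and> D w v y z \<and> D w x v z \<and> D w x y v))"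

definition splitting :: "'a set \<Rightarrow> ('a \<Rightarrow> 'a \<Rightarrow> 'a \<Rightarrow> 'a \<Rightarrow> bool) \<Rightarrow> 'a set set \<Rightarrow> bool" where
  "splitting X D S \<longleftrightarrow>
     partition_on X S \<and> (infinite S \<or> 2 \<le> card S) \<and>
     (\<forall>\<Sigma>\<in>S. \<forall>a\<in>\<Sigma>. \<forall>b\<in>\<Sigma>. \<forall>c\<in>X - \<Sigma>. \<forall>d\<in>X - \<Sigma>. D a b c d) \<and>
     (\<forall>A\<in>S. \<forall>B\<in>S. \<forall>C\<in>S. \<forall>E\<in>S. distinct [A, B, C, E] \<longrightarrow>
        (\<forall>a\<in>A. \<forall>b\<in>B. \<forall>c\<in>C. \<forall>d\<in>E. \<not> D a b c d))"

definition node_splitting :: "'a set \<Rightarrow> ('a \<Rightarrow> 'a \<Rightarrow> 'a \<Rightarrow> 'a \<Rightarrow> bool) \<Rightarrow> 'a set set \<Rightarrow> bool" where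
  "node_splitting X D S \<longleftrightarrow> splitting X D S \<and> (infinite S \<or> 2 < card S)"

definition edge_splitting :: "'a set \<Rightarrow> ('a \<Rightarrow> 'a \<Rightarrow> 'a \<Rightarrow> 'a \<Rightarrow> bool) \<Rightarrow> 'a set set \<Rightarrow> bool" where
  "edge_splitting X D S \<longleftrightarrow> splitting X D S \<and> card S = 2"

definition true_edge_splitting ::
    "'a set \<Rightarrow> ('a \<Rightarrow> 'a \<Rightarrow> 'a \<Rightarrow> 'a \<Rightarrow> bool) \<Rightarrow> 'a set set \<Rightarrow> bool" where
  "true_edge_splitting X D S \<longleftrightarrow>
     edge_splitting X D S \<and>
     \<not> (\<exists>T. node_splitting X D T \<and> refines X T S) \<and>
     (\<forall>\<Sigma>\<in>S. \<not> is_singleton \<Sigma>)"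

definition DP_iso ::
    "('a \<Rightarrow> 'a \<Rightarrow> 'a \<Rightarrow> 'a \<Rightarrow> bool) \<Rightarrow> 'a set \<Rightarrow> 'a set \<Rightarrow> 'a set \<Rightarrow> ('a \<Rightarrow> 'a) \<Rightarrow> bool" where
  "DP_iso D P A B f \<longleftrightarrow>
     bij_betw f A B \<and>
     (\<forall>w\<in>A. \<forall>x\<in>A. \<forall>y\<in>A. \<forall>z\<in>A. D (f w) (f x) (f y) (f z) \<longleftrightarrow> D w x y z) \<and>
     (\<forall>x\<in>A. f x \<in> P \<longleftrightarrow> x \<in> P)"

definition P_homogeneous ::
    "'a set \<Rightarrow> ('a \<Rightarrow> 'a \<Rightarrow> 'a \<Rightarrow> 'a \<Rightarrow> bool) \<Rightarrow> 'a set \<Rightarrow> bool" where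
  "P_homogeneous X D P \<longleftrightarrow>
     (\<forall>A B f. A \<subseteq> X \<and> finite A \<and> B \<subseteq> X \<and> finite B \<and>
        A \<inter> P \<noteq> {} \<and> A - P \<noteq> {} \<and> B \<inter> P \<noteq> {} \<and> B - P \<noteq> {} \<and>
        DP_iso D P A B f \<longrightarrow>
        (\<exists>g. DP_iso D P X X g \<and> (\<forall>a\<in>A. g a = f a)))"

text \<open>
  For countable \<open>X\<close> every splitting has countably many sectors, so the common number of sectors
  is automatically a natural number above \<open>2\<close> or countably infinite.
\<close>

definition same_node_valency :: "'a set \<Rightarrow> ('a \<Rightarrow> 'a \<Rightarrow> 'a \<Rightarrow> 'a \<Rightarrow> bool) \<Rightarrow> bool" where
  "same_node_valency X D \<longleftrightarrow>
     (\<forall>S T. node_splitting X D S \<and> node_splitting X D T \<longrightarrow> S \<approx> T)"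

end

theory Submission
  imports Defs
begin

text \<open>
  Think of a D-set as the set of leaves of a tree-like object: \<open>D w x y z\<close> says that the path
  from \<open>w\<close> to \<open>x\<close> misses the path from \<open>y\<close> to \<open>z\<close>, and three distinct points determine a node.

  A point \<open>x\<close> attaches to a finite set \<open>A\<close> either inside an edge of the tree spanned by \<open>A\<close> or in
  an unused sector at one of its nodes. Density realises the first type over any isomorphic copy of
  \<open>A\<close>, constant valency the second, so a countable dense D-set of constant valency is homogeneous by
  back-and-forth; the colour of the new point can be prescribed if every sector contains both
  colours. This gives case (a) and case (c). In case (b) the set \<open>P\<close> together with one point of the
  complement is again dense of constant valency, because no node sits at the end of the edge;
  automorphisms of the two sides are glued.

  Conversely, homogeneity is used by fixing two points \<open>p\<close>, \<open>q\<close> of different colours and moving a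
  third. A gap on the path from \<open>p\<close> to \<open>q\<close> would be reproduced everywhere along that path, which
  contradicts moving the far end of the gap outwards. If some infinite sector lies in \<open>P\<close>, then
  moving one of its points to any other point of \<open>P\<close> shows that \<open>P\<close> itself is a sector.
\<close>

text \<open>Every use of homogeneity has to keep two points of different colours in the domain, and
  this shapes the converse. Over such a pair alone all D-relations are degenerate, so any two
  further points of one colour can be exchanged, but points of different colours never can. The
  density argument can therefore push a point outwards only onto a point of its own colour; when
  everything beyond the gap has the opposite colour, a second argument is needed. Valencies in
  \<open>P\<close> are compared through triples together with a fixed outside point
  \<open>q\<close>, and \<open>q\<close> may hang from a node of \<open>P\<close> itself instead of
  lying in one of its sectors. Such a node turns out to have only one-point sectors and to be the
  only node of \<open>P\<close>. Properness enters as the infinity of cones, so removing one point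
  never empties a sector. The extension theorem is stated for the carrier of the locale and an
  arbitrary colour class: it is applied to \<open>X\<close> with the colours, to \<open>X\<close>
  without them, and to one side of an edge enlarged by a single point.\<close>

section \<open>Calculus of the relation D\<close>

locale D_structure =
  fixes X :: "'a set" and D :: "'a \<Rightarrow> 'a \<Rightarrow> 'a \<Rightarrow> 'a \<Rightarrow> bool"
  assumes D_set: "D_set X D"
begin

lemma D_swap_left: "D w x y z \<Longrightarrow> w \<in> X \<Longrightarrow> x \<in> X \<Longrightarrow> y \<in> X \<Longrightarrow> z \<in> X \<Longrightarrow> D x w y z"
  using D_set unfolding D_set_def by blast

lemma D_swap_sides: "D w x y z \<Longrightarrow> w \<in> X \<Longrightarrow> x \<in> X \<Longrightarrow> y \<in> X \<Longrightarrow> z \<in> X \<Longrightarrow> D y z w x"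
  using D_set unfolding D_set_def by blast

lemma D_swap_right: "D w x y z \<Longrightarrow> w \<in> X \<Longrightarrow> x \<in> X \<Longrightarrow> y \<in> X \<Longrightarrow> z \<in> X \<Longrightarrow> D w x z y"
  by (meson D_swap_left D_swap_sides)

lemma D_excl: "D w x y z \<Longrightarrow> w \<in> X \<Longrightarrow> x \<in> X \<Longrightarrow> y \<in> X \<Longrightarrow> z \<in> X \<Longrightarrow> \<not> D w y x z"
  using D_set unfolding D_set_def by blast

lemma D_either:
  "D w x y z \<Longrightarrow> w \<in> X \<Longrightarrow> x \<in> X \<Longrightarrow> y \<in> X \<Longrightarrow> z \<in> X \<Longrightarrow> v \<in> X \<Longrightarrow> D v x y z \<or> D w x y v"
  using D_set unfolding D_set_def by blast

lemma D_point: "w \<noteq> y \<Longrightarrow> x \<noteq> y \<Longrightarrow> w \<in> X \<Longrightarrow> x \<in> X \<Longrightarrow> y \<in> X \<Longrightarrow> D w x y y"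
  using D_set unfolding D_set_def by blast

lemma D_point_left: "w \<noteq> y \<Longrightarrow> w \<noteq> z \<Longrightarrow> w \<in> X \<Longrightarrow> y \<in> X \<Longrightarrow> z \<in> X \<Longrightarrow> D w w y z"
  by (metis D_point D_swap_sides)

lemma D_disjoint:
  "D w x y z \<Longrightarrow> w \<in> X \<Longrightarrow> x \<in> X \<Longrightarrow> y \<in> X \<Longrightarrow> z \<in> X \<Longrightarrow> w \<noteq> y \<and> w \<noteq> z \<and> x \<noteq> y \<and> x \<noteq> z"
  by (metis D_excl D_swap_left D_swap_right)

lemma D_degenerate_iff:
  "\<not> distinct [w, x, y, z] \<Longrightarrow> w \<in> X \<Longrightarrow> x \<in> X \<Longrightarrow> y \<in> X \<Longrightarrow> z \<in> X \<Longrightarrow>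
    D w x y z \<longleftrightarrow> w \<noteq> y \<and> w \<noteq> z \<and> x \<noteq> y \<and> x \<noteq> z"
  using D_disjoint[of w x y z] D_point[of w y x] D_point_left[of w y z] by auto

text \<open>If it failed, \<open>D_either\<close> applied to the two hypotheses would give both
  \<open>D v u a w\<close> and \<open>D v w a u\<close>, which \<open>D_excl\<close>
  forbids.\<close>

lemma D_trans:
  assumes "D u v a b" "D v w a b" "u \<in> X" "v \<in> X" "w \<in> X" "a \<in> X" "b \<in> X"
  shows "D u w a b"
  using assms D_either[of v u a b w] D_either[of v w a b u] D_excl[of v u w a]
  by (meson D_swap_left D_swap_right)

lemma D_trans_right:
  assumes "D u v a b" "D u v b c" "u \<in> X" "v \<in> X" "a \<in> X" "b \<in> X" "c \<in> X"
  shows "D u v a c"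
  using assms by (meson D_trans D_swap_sides)

text \<open>This is what makes \<open>co_sector\<close> transitive when the two relations come from
  different pairs of the triple. If both alternatives fail, \<open>v\<close> is joined to
  \<open>c\<close> away from \<open>a, b\<close> and also to \<open>a\<close> away from
  \<open>b, c\<close>, which is a crossing.\<close>

lemma D_trans_overlap:
  assumes "D u v a b" "D v w b c" "u \<in> X" "v \<in> X" "w \<in> X" "a \<in> X" "b \<in> X" "c \<in> X"
  shows "D u w a b \<or> D u w b c"
proof (rule ccontr)
  assume neg: "\<not> ?thesis"
  have "D c v a b"
    using assms neg D_either[of u v b a c] by (meson D_trans D_swap_right)
  moreover have "D a v b c"
    using assms neg D_either[of w v b c a] by (meson D_trans D_swap_left D_swap_right)
  ultimately show False
    using assms D_excl[of v c a b] by (meson D_swap_left D_swap_right)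
qed

end

section \<open>Nodes and splittings\<close>

text \<open>
  For distinct \<open>a\<close>, \<open>b\<close>, \<open>c\<close> this says that \<open>u\<close> and \<open>v\<close> lie in the same sector at the median
  of \<open>a\<close>, \<open>b\<close>, \<open>c\<close>: a sector contains at most one of \<open>a\<close>, \<open>b\<close>, \<open>c\<close>, so it is separated from
  the other two.
\<close>

definition co_sector ::
    "('a \<Rightarrow> 'a \<Rightarrow> 'a \<Rightarrow> 'a \<Rightarrow> bool) \<Rightarrow> 'a \<Rightarrow> 'a \<Rightarrow> 'a \<Rightarrow> 'a \<Rightarrow> 'a \<Rightarrow> bool" where
  "co_sector D a b c u v \<longleftrightarrow> D u v a b \<or> D u v b c \<or> D u v a c"

text \<open>Any node splitting has this form for arbitrary representatives of any three of its
  sectors (\<open>node_splitting_eq_node_at\<close>), so statements about nodes become statements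
  about triples of points.\<close>

definition node_at ::
    "'a set \<Rightarrow> ('a \<Rightarrow> 'a \<Rightarrow> 'a \<Rightarrow> 'a \<Rightarrow> bool) \<Rightarrow> 'a \<Rightarrow> 'a \<Rightarrow> 'a \<Rightarrow> 'a set set" where
  "node_at X D a b c = (\<lambda>u. {v \<in> X. co_sector D a b c u v}) ` X"

locale D_triple = D_structure +
  fixes a b c :: 'a
  assumes in_X: "a \<in> X" "b \<in> X" "c \<in> X"
    and triple_distinct: "a \<noteq> b" "a \<noteq> c" "b \<noteq> c"
begin

abbreviation S where "S \<equiv> co_sector D a b c"

lemma co_sector_refl: "u \<in> X \<Longrightarrow> S u u"
  unfolding co_sector_def using D_point_left in_X triple_distinct by metis

lemma co_sector_sym: "S u v \<Longrightarrow> u \<in> X \<Longrightarrow> v \<in> X \<Longrightarrow> S v u"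
  unfolding co_sector_def using D_swap_left in_X by metis

lemma co_sector_trans:
  assumes "S u v" "S v w" "u \<in> X" "v \<in> X" "w \<in> X"
  shows "S u w"
proof -
  have sw: "D x y r s \<longleftrightarrow> D x y s r" if "x \<in> X" "y \<in> X" "r \<in> X" "s \<in> X" for x y r s
    using that D_swap_right by blast
  show ?thesis
    using assms in_X D_trans[of u v _ _ w] D_trans_overlap[of u v _ _ w] sw
    unfolding co_sector_def by (smt (verit))
qed

text \<open>The relation \<open>S u v\<close> separates \<open>u, v\<close> from some pair of the
  triple. By \<open>D_either\<close> one end of that pair can be replaced by any point outside the
  sector, since the other alternative would put that point inside. Doing this for \<open>y\<close>
  and for \<open>z\<close> and joining the results gives the claim.\<close>

lemma separated_of_co_sector:
  assumes "S u v" "\<not> S u y" "\<not> S u z" and X: "u \<in> X" "v \<in> X" "y \<in> X" "z \<in> X"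
  shows "D u v y z"
proof -
  have *: "D u v r w"
    if "D u v r s" "\<not> S u w" "D w v r s \<Longrightarrow> S w v" "r \<in> X" "s \<in> X" "w \<in> X" for r s w
    using that X D_either[of u v r s w] assms(1) by (meson co_sector_sym co_sector_trans)
  have **: "D u v y z"
    if "D u v r s" "\<And>w. D w v r s \<Longrightarrow> S w v" "r \<in> X" "s \<in> X" for r s
    using *[OF that(1), of y] *[OF that(1), of z] that assms(2,3) X
    by (meson D_trans_right D_swap_right)
  show ?thesis
    using assms(1) **[of a b] **[of b c] **[of a c] in_X unfolding co_sector_def by blast
qed

text \<open>A pigeonhole argument: by \<open>D_either\<close> each of \<open>a, b, c\<close> is
  separated either from \<open>u, v\<close> together with \<open>y\<close>, or from
  \<open>y, z\<close> together with \<open>v\<close>. Two of the three fall under the same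
  alternative and witness the corresponding \<open>S\<close>.\<close>

lemma co_sector_of_separated:
  assumes "D u v y z" and X: "u \<in> X" "v \<in> X" "y \<in> X" "z \<in> X"
  shows "S u v \<or> S y z"
proof -
  have pair: "S u v \<or> S y z"
    if "D u v r y \<and> D u v s y \<or> D r v y z \<and> D s v y z" "r \<in> X" "s \<in> X"
      "D u v r s \<Longrightarrow> S u v" "D y z r s \<Longrightarrow> S y z" for r s
    using that X by (meson D_trans D_trans_right D_swap_left D_swap_right D_swap_sides)
  have "D u v r y \<or> D r v y z" if "r \<in> X" for r
    using assms that by (meson D_either D_swap_right)
  then show ?thesis
    using pair[of a b] pair[of b c] pair[of a c] in_X unfolding co_sector_def by blast
qed

lemma node_at_eq_iff:
  assumes "u \<in> X" "v \<in> X"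
  shows "{w \<in> X. S u w} = {w \<in> X. S v w} \<longleftrightarrow> S u v"
proof
  show "S u v" if "{w \<in> X. S u w} = {w \<in> X. S v w}"
    using that assms co_sector_refl by blast
  show "{w \<in> X. S u w} = {w \<in> X. S v w}" if "S u v"
    using that assms co_sector_sym[of u v] co_sector_trans[of u v] co_sector_trans[of v u] by blast
qed

lemma triple_not_co_sector: "\<not> S a b" "\<not> S a c" "\<not> S b c"
  unfolding co_sector_def using D_disjoint in_X by blast+

lemma node_at_partition: "partition_on X (node_at X D a b c)"
proof (rule partition_onI)
  show "\<Union> (node_at X D a b c) = X"
    unfolding node_at_def using co_sector_refl by auto
  show "disjnt p q" if "p \<in> node_at X D a b c" "q \<in> node_at X D a b c" "p \<noteq> q" for p q
  proof -
    obtain u v where uv: "u \<in> X" "v \<in> X" "p = {w \<in> X. S u w}" "q = {w \<in> X. S v w}"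
      using \<open>p \<in> _\<close> \<open>q \<in> _\<close> unfolding node_at_def by blast
    then have "\<not> S u v" using node_at_eq_iff \<open>p \<noteq> q\<close> by blast
    then have "\<not> (S u w \<and> S v w)" if "w \<in> X" for w
      using uv that co_sector_sym[of v w] co_sector_trans[of u w v] by blast
    then show ?thesis using uv unfolding disjnt_def by blast
  qed
  show "{} \<notin> node_at X D a b c"
    using co_sector_refl unfolding node_at_def by auto
qed

lemma node_at_mem_iff:
  assumes "\<Sigma> \<in> node_at X D a b c" "u \<in> \<Sigma>"
  shows "v \<in> \<Sigma> \<longleftrightarrow> v \<in> X \<and> S u v"
proof -
  obtain t where t: "t \<in> X" "\<Sigma> = {w \<in> X. S t w}"
    using assms unfolding node_at_def by blast
  then have "u \<in> X" "S t u" "S u t" using assms co_sector_sym by auto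
  then show ?thesis using t co_sector_trans[of t u v] co_sector_trans[of u t v] by blast
qed

lemma node_at_subset: "\<Sigma> \<in> node_at X D a b c \<Longrightarrow> u \<in> \<Sigma> \<Longrightarrow> u \<in> X"
  unfolding node_at_def by auto

lemma three_in_node_at:
  "{{w \<in> X. S a w}, {w \<in> X. S b w}, {w \<in> X. S c w}} \<subseteq> node_at X D a b c"
  "card {{w \<in> X. S a w}, {w \<in> X. S b w}, {w \<in> X. S c w}} = 3"
  unfolding node_at_def using in_X node_at_eq_iff triple_not_co_sector by auto

lemma node_splitting_node_at: "node_splitting X D (node_at X D a b c)"
proof -
  have many: "infinite (node_at X D a b c) \<or> 3 \<le> card (node_at X D a b c)"
    using three_in_node_at card_mono[OF _ three_in_node_at(1)] by linarith
  have inside: "D u v y z"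
    if "\<Sigma> \<in> node_at X D a b c" "u \<in> \<Sigma>" "v \<in> \<Sigma>" "y \<in> X - \<Sigma>" "z \<in> X - \<Sigma>" for \<Sigma> u v y z
  proof (rule separated_of_co_sector)
    show "S u v" using node_at_mem_iff[OF that(1,2)] that by blast
    show "\<not> S u y" using node_at_mem_iff[OF that(1,2)] that by blast
    show "\<not> S u z" using node_at_mem_iff[OF that(1,2)] that by blast
  qed (use that node_at_subset in auto)
  have across: "\<not> D u v y z"
    if "A \<in> node_at X D a b c" "B \<in> node_at X D a b c" "C \<in> node_at X D a b c"
      "E \<in> node_at X D a b c" "A \<noteq> B" "C \<noteq> E" "u \<in> A" "v \<in> B" "y \<in> C" "z \<in> E" for A B C E u v y z
  proof -
    have "\<not> S u v" "\<not> S y z"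
      using that node_at_partition node_at_mem_iff[of A u v] node_at_mem_iff[of C y z] node_at_subset
      unfolding partition_on_def disjoint_def by blast+
    then show ?thesis
      using that co_sector_of_separated[of u v y z] node_at_subset by metis
  qed
  show ?thesis
    unfolding node_splitting_def splitting_def
    using node_at_partition many inside across by auto
qed

end

section \<open>Splittings and nearest pairs\<close>

context D_structure
begin

lemma splitting_partition: "splitting X D S \<Longrightarrow> partition_on X S"
  unfolding splitting_def by (elim conjE)

lemma splitting_sectors_cases:
  assumes "splitting X D S" "u \<in> X"
  obtains \<Sigma> where "\<Sigma> \<in> S" "u \<in> \<Sigma>"
  using splitting_partition[OF assms(1)] assms(2) unfolding partition_on_def by blast

lemma splitting_sector_unique:
  assumes "splitting X D S" "A \<in> S" "B \<in> S" "u \<in> A" "u \<in> B"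
  shows "A = B"
  using splitting_partition[OF assms(1)] assms(2-) unfolding partition_on_def disjoint_def by blast

lemma splitting_subset: "splitting X D S \<Longrightarrow> A \<in> S \<Longrightarrow> A \<subseteq> X"
  by (drule splitting_partition) (auto simp: partition_on_def)

lemma splitting_inside:
  "splitting X D S \<Longrightarrow> \<Sigma> \<in> S \<Longrightarrow> u \<in> \<Sigma> \<Longrightarrow> v \<in> \<Sigma> \<Longrightarrow> y \<in> X - \<Sigma> \<Longrightarrow> z \<in> X - \<Sigma> \<Longrightarrow> D u v y z"
  unfolding splitting_def by (elim conjE) metis

lemma splitting_across:
  "splitting X D S \<Longrightarrow> A \<in> S \<Longrightarrow> B \<in> S \<Longrightarrow> C \<in> S \<Longrightarrow> E \<in> S \<Longrightarrow> distinct [A, B, C, E] \<Longrightarrow>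
    u \<in> A \<Longrightarrow> v \<in> B \<Longrightarrow> y \<in> C \<Longrightarrow> z \<in> E \<Longrightarrow> \<not> D u v y z"
  unfolding splitting_def by (elim conjE) metis

text \<open>A converse to \<open>splitting_inside\<close>. If \<open>u\<close> and \<open>v\<close>
  were in different sectors, then either one of these sectors is \<open>A\<close> or
  \<open>B\<close>, and the first splitting clause gives a relation crossing
  \<open>D u v a b\<close>, or the four sectors are distinct and the second clause applies.\<close>

lemma splitting_separates:
  assumes S: "splitting X D S" and sec: "A \<in> S" "B \<in> S" "A \<noteq> B" "a \<in> A" "b \<in> B"
    and D: "D u v a b" and X: "u \<in> X" "v \<in> X"
  shows "\<exists>\<Sigma>\<in>S. u \<in> \<Sigma> \<and> v \<in> \<Sigma>"
proof -
  obtain U V where UV: "U \<in> S" "u \<in> U" "V \<in> S" "v \<in> V"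
    using splitting_sectors_cases[OF S] X by metis
  have ab: "a \<in> X" "b \<in> X" using sec splitting_subset[OF S] by auto
  show ?thesis
  proof (rule ccontr)
    assume "\<not> ?thesis"
    then have "U \<noteq> V" using UV by blast
    note uniq = splitting_sector_unique[OF S]
    have "U \<noteq> A"
      using splitting_inside[OF S, of A u a v b] sec UV \<open>U \<noteq> V\<close> uniq D D_excl X ab
      by (metis Diff_iff)
    moreover have "U \<noteq> B"
      using splitting_inside[OF S, of B u b v a] sec UV \<open>U \<noteq> V\<close> uniq D D_excl D_swap_right X ab
      by (metis Diff_iff)
    moreover have "V \<noteq> A"
      using splitting_inside[OF S, of A v a u b] sec UV \<open>U \<noteq> V\<close> uniq D D_excl D_swap_left X ab
      by (metis Diff_iff)
    moreover have "V \<noteq> B"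
      using splitting_inside[OF S, of B v b u a] sec UV \<open>U \<noteq> V\<close> uniq D D_excl D_swap_left D_swap_right X ab
      by (metis Diff_iff)
    ultimately show False
      using splitting_across[OF S, of U V A B u v a b] UV sec \<open>U \<noteq> V\<close> D by auto
  qed
qed

text \<open>A sector contains at most one of \<open>a, b, c\<close>, so its points are separated
  from the other two; \<open>splitting_separates\<close> gives the reverse inclusion. Thus three
  points in different sectors determine the whole splitting.\<close>

lemma node_splitting_eq_node_at:
  assumes S: "splitting X D S" and sec: "A \<in> S" "B \<in> S" "C \<in> S" "distinct [A, B, C]"
    and mem: "a \<in> A" "b \<in> B" "c \<in> C"
  shows "S = node_at X D a b c" "D_triple X D a b c"
proof -
  note uniq = splitting_sector_unique[OF S]
  have abc: "a \<in> X" "b \<in> X" "c \<in> X" using sec mem splitting_subset[OF S] by auto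
  show "D_triple X D a b c"
    using D_structure_axioms abc sec mem uniq
    unfolding D_triple_def D_triple_axioms_def by auto
  then interpret D_triple X D a b c .
  have iff: "co_sector D a b c u v \<longleftrightarrow> v \<in> \<Sigma>" if "\<Sigma> \<in> S" "u \<in> \<Sigma>" "v \<in> X" for u v \<Sigma>
  proof
    assume "co_sector D a b c u v"
    then have "\<exists>\<Sigma>'\<in>S. u \<in> \<Sigma>' \<and> v \<in> \<Sigma>'"
      using splitting_separates[OF S] sec mem that splitting_subset[OF S]
      unfolding co_sector_def by (smt (verit) distinct_length_2_or_more subsetD)
    then show "v \<in> \<Sigma>" using uniq that by blast
  next
    assume v: "v \<in> \<Sigma>"
    have "(a \<notin> \<Sigma> \<and> b \<notin> \<Sigma>) \<or> (b \<notin> \<Sigma> \<and> c \<notin> \<Sigma>) \<or> (a \<notin> \<Sigma> \<and> c \<notin> \<Sigma>)"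
      using uniq sec mem that by (metis distinct_length_2_or_more)
    then show "co_sector D a b c u v"
      using splitting_inside[OF S \<open>\<Sigma> \<in> S\<close> \<open>u \<in> \<Sigma>\<close> v] abc unfolding co_sector_def by blast
  qed
  have eq: "{v \<in> X. co_sector D a b c u v} = \<Sigma>" if "\<Sigma> \<in> S" "u \<in> \<Sigma>" for u \<Sigma>
    using iff[OF that] splitting_subset[OF S that(1)] by blast
  show "S = node_at X D a b c"
  proof (intro set_eqI iffI)
    fix \<Sigma> assume "\<Sigma> \<in> S"
    moreover from this obtain u where "u \<in> \<Sigma>"
      using splitting_partition[OF S] unfolding partition_on_def by fastforce
    ultimately show "\<Sigma> \<in> node_at X D a b c"
      using eq splitting_subset[OF S] unfolding node_at_def by blast
  next
    fix \<Sigma> assume "\<Sigma> \<in> node_at X D a b c"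
    then obtain u where u: "u \<in> X" "\<Sigma> = {v \<in> X. co_sector D a b c u v}"
      unfolding node_at_def by blast
    then show "\<Sigma> \<in> S" using eq splitting_sectors_cases[OF S] by metis
  qed
qed

lemma node_splitting_obtains:
  assumes "node_splitting X D S"
  obtains A B C a b c where "A \<in> S" "B \<in> S" "C \<in> S" "distinct [A, B, C]" "a \<in> A" "b \<in> B" "c \<in> C"
proof -
  obtain U where U: "U \<subseteq> S" "card U = 3"
    using assms unfolding node_splitting_def
    by (metis infinite_arbitrarily_large less_eq_Suc_le numeral_3_eq_3 numeral_2_eq_2 obtain_subset_with_card_n)
  then obtain A B C where "U = {A, B, C}" "A \<noteq> B" "A \<noteq> C" "B \<noteq> C"
    using card_3_iff by metis
  moreover have "{} \<notin> S"
    using assms splitting_partition unfolding node_splitting_def partition_on_def by metis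
  ultimately show ?thesis using that U by (metis distinct_length_2_or_more distinct_singleton
      equals0I insertCI insert_subset)
qed

text \<open>In the tree spanned by \<open>F\<close> and \<open>r\<close>, the edge ending in
  \<open>r\<close> starts where the paths from \<open>a\<close> and \<open>b\<close> to
  \<open>r\<close> meet (at \<open>a\<close> itself if \<open>a = b\<close>). In the induction, a
  new point \<open>s\<close> that branches off still nearer to \<open>r\<close> replaces
  \<open>b\<close>.\<close>

lemma exists_nearest_pair:
  assumes "finite F" "F \<noteq> {}" "F \<subseteq> X" "r \<in> X" "r \<notin> F"
  shows "\<exists>a\<in>F. \<exists>b\<in>F. \<forall>s\<in>F. \<not> D a b s r"
  using assms
proof (induction F rule: finite_ne_induct)
  case (singleton x)
  then show ?case using D_disjoint by blast
next
  case (insert s F)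
  then obtain a b where ab: "a \<in> F" "b \<in> F" "\<And>t. t \<in> F \<Longrightarrow> \<not> D a b t r" by auto
  have X: "a \<in> X" "b \<in> X" "s \<in> X" "r \<in> X" using insert ab by auto
  show ?case
  proof (cases "D a b s r")
    case False
    then show ?thesis using ab by blast
  next
    case True
    have "\<not> D a s t r" if "t \<in> insert s F" for t
    proof
      assume D: "D a s t r"
      have tX: "t \<in> X" using that insert by auto
      have "t \<noteq> s" using D X D_disjoint by blast
      then have "\<not> D a b t r" using ab that by blast
      then have "D t b r s"
        using D_either[of a b r s t] True X tX by (meson D_swap_right)
      then have "D t a r s"
        using True X tX by (meson D_trans D_swap_left D_swap_right)
      then show False using D D_excl X tX by (meson D_swap_left D_swap_right)
    qed
    then show ?thesis using ab by blast
  qed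
qed

end

section \<open>Back-and-forth\<close>

lemma DP_iso_inv_into:
  assumes "DP_iso D P A B f"
  shows "DP_iso D P B A (inv_into A f)"
proof -
  have bij: "bij_betw f A B" using assms unfolding DP_iso_def by blast
  have inv: "inv_into A f y \<in> A" "f (inv_into A f y) = y" if "y \<in> B" for y
    using bij that by (simp_all add: bij_betw_def inv_into_into f_inv_into_f)
  show ?thesis
    unfolding DP_iso_def
  proof (intro conjI ballI)
    show "bij_betw (inv_into A f) B A" using bij by (rule bij_betw_inv_into)
  next
    fix w x y z assume "w \<in> B" "x \<in> B" "y \<in> B" "z \<in> B"
    then show "D (inv_into A f w) (inv_into A f x) (inv_into A f y) (inv_into A f z) \<longleftrightarrow> D w x y z"
      using assms inv unfolding DP_iso_def by metis
  next
    fix x assume "x \<in> B"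
    then show "inv_into A f x \<in> P \<longleftrightarrow> x \<in> P" using assms inv unfolding DP_iso_def by metis
  qed
qed

text \<open>Domains have at least two points because this is what the extension step needs: over a
  single point the separation relations say nothing about a new point.\<close>

lemma back_and_forth:
  fixes R :: "'a set"
  assumes "countable R"
    and forth: "\<And>A B f x. finite A \<Longrightarrow> 2 \<le> card A \<Longrightarrow> A \<subseteq> R \<Longrightarrow> B \<subseteq> R \<Longrightarrow> DP_iso D P A B f \<Longrightarrow> x \<in> R - A \<Longrightarrow>
      \<exists>y\<in>R. DP_iso D P (insert x A) (insert y B) (f(x := y))"
    and A0: "finite A0" "2 \<le> card A0" "A0 \<subseteq> R" "B0 \<subseteq> R" "DP_iso D P A0 B0 f0"
  shows "\<exists>g. DP_iso D P R R g \<and> (\<forall>a\<in>A0. g a = f0 a)"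
proof -
  define e where "e = from_nat_into R"
  define Q where "Q = (\<lambda>(A, B, f). finite A \<and> 2 \<le> card A \<and> A \<subseteq> R \<and> B \<subseteq> R \<and> DP_iso D P A B f)"
  define ext where "ext = (\<lambda>(A :: 'a set, B :: 'a set, f) (A', B', f'). A \<subseteq> A' \<and> B \<subseteq> B' \<and> (\<forall>a\<in>A. f' a = (f a :: 'a)))"
  have "A0 \<noteq> {}" using A0 by auto
  then have ne: "R \<noteq> {}" using A0 by auto
  then have e_in: "e n \<in> R" for n unfolding e_def by (rule from_nat_into)
  have Qforth: "\<exists>t. Q t \<and> ext s t \<and> x \<in> fst t" if Qs: "Q s" "x \<in> R" for s x
  proof -
    obtain A B f where s: "s = (A, B, f)" by (cases s)
    show ?thesis
    proof (cases "x \<in> A")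
      case True
      then show ?thesis using that s unfolding ext_def by auto
    next
      case False
      then obtain y where y: "y \<in> R" "DP_iso D P (insert x A) (insert y B) (f(x := y))"
        using forth[of A B f x] Qs s unfolding Q_def by auto
      then have "Q (insert x A, insert y B, f(x := y))"
        using that s False unfolding Q_def by auto
      moreover have "ext s (insert x A, insert y B, f(x := y))"
        using s False unfolding ext_def by auto
      ultimately show ?thesis by (metis fst_conv insertI1)
    qed
  qed
  \<comment> \<open>The back step is the forth step for the inverse map. The extended inverse is
    inverted once more, and this double inverse agrees with \<open>f\<close> on
    \<open>A\<close>.\<close>
  have Qback: "\<exists>t. Q t \<and> ext s t \<and> y \<in> fst (snd t)" if Qs: "Q s" "y \<in> R" for s y
  proof -
    obtain A B f where s: "s = (A, B, f)" by (cases s)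
    have fin: "finite A" "2 \<le> card A" "A \<subseteq> R" "B \<subseteq> R" "DP_iso D P A B f"
      using that s unfolding Q_def by auto
    have bij: "bij_betw f A B" using fin unfolding DP_iso_def by blast
    have "Q (B, A, inv_into A f)"
      using fin DP_iso_inv_into[OF fin(5)] bij_betw_finite[OF bij] bij_betw_same_card[OF bij]
      unfolding Q_def by auto
    then obtain B' A' h where t: "Q (B', A', h)" "ext (B, A, inv_into A f) (B', A', h)" "y \<in> B'"
      using Qforth[OF _ Qs(2)] by (metis fst_conv prod_cases3)
    have iso: "DP_iso D P B' A' h" and fin': "finite B'" "2 \<le> card B'" "A' \<subseteq> R" "B' \<subseteq> R"
      using t unfolding Q_def by auto
    have bij': "bij_betw h B' A'" using iso unfolding DP_iso_def by blast
    have "Q (A', B', inv_into B' h)"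
      using fin' DP_iso_inv_into[OF iso] bij_betw_finite[OF bij'] bij_betw_same_card[OF bij']
      unfolding Q_def by auto
    moreover have "inv_into B' h a = f a" if "a \<in> A" for a
    proof -
      have "f a \<in> B" using bij that unfolding bij_betw_def by auto
      then have "f a \<in> B'" "h (f a) = a"
        using t(2) bij that unfolding ext_def by (auto simp: bij_betw_def)
      then show ?thesis using bij' unfolding bij_betw_def by (metis inv_into_f_f)
    qed
    then have "ext s (A', B', inv_into B' h)"
      using s t(2) unfolding ext_def by auto
    ultimately show ?thesis using t(3) by force
  qed
  have ext_trans: "ext s u" if "ext s t" "ext t u" for s t u
    using that unfolding ext_def by (auto split: prod.splits)
  \<comment> \<open>The clause for \<open>n = 0\<close> inside the invariant makes the sequence
    given by dependent choice start with the prescribed map.\<close>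
  have "\<exists>s. \<forall>n. (Q (s n) \<and> (n = 0 \<longrightarrow> s n = (A0, B0, f0))) \<and>
      (ext (s n) (s (Suc n)) \<and> e n \<in> fst (s (Suc n)) \<and> e n \<in> fst (snd (s (Suc n))))"
  proof (rule dependent_nat_choice)
    show "\<exists>x. Q x \<and> (0 = 0 \<longrightarrow> x = (A0, B0, f0))" using A0 unfolding Q_def by auto
  next
    fix s and n :: nat assume "Q s \<and> (n = 0 \<longrightarrow> s = (A0, B0, f0))"
    then obtain t where t: "Q t" "ext s t" "e n \<in> fst t" using Qforth e_in by blast
    then obtain u where u: "Q u" "ext t u" "e n \<in> fst (snd u)" using Qback e_in by blast
    have "e n \<in> fst u" using t(3) u(2) unfolding ext_def by (auto split: prod.splits)
    then show "\<exists>u. (Q u \<and> (Suc n = 0 \<longrightarrow> u = (A0, B0, f0))) \<and>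
        ext s u \<and> e n \<in> fst u \<and> e n \<in> fst (snd u)"
      using u ext_trans[OF t(2) u(2)] by blast
  qed
  then obtain s where s: "\<And>n. Q (s n)" "s 0 = (A0, B0, f0)" "\<And>n. ext (s n) (s (Suc n))"
    "\<And>n. e n \<in> fst (s (Suc n))" "\<And>n. e n \<in> fst (snd (s (Suc n)))"
    by blast
  define dm where "dm n = fst (s n)" for n
  define rg where "rg n = fst (snd (s n))" for n
  define fn where "fn n = snd (snd (s n))" for n
  have sn: "s n = (dm n, rg n, fn n)" for n unfolding dm_def rg_def fn_def by simp
  have Qn: "dm n \<subseteq> R" "rg n \<subseteq> R" "DP_iso D P (dm n) (rg n) (fn n)" for n
    using s(1)[of n] unfolding sn Q_def by auto
  have mono: "dm m \<subseteq> dm n \<and> rg m \<subseteq> rg n \<and> (\<forall>a\<in>dm m. fn n a = fn m a)" if "m \<le> n" for m n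
    using that
  proof (induction n rule: dec_induct)
    case (step n)
    then show ?case using s(3)[of n] unfolding sn ext_def by auto
  qed auto
  have dm_ex: "\<exists>n. a \<in> dm n" if "a \<in> R" for a
    using that s(4) from_nat_into_surj[OF \<open>countable R\<close> that] unfolding dm_def e_def by metis
  have rg_ex: "\<exists>n. a \<in> rg n" if "a \<in> R" for a
    using that s(5) from_nat_into_surj[OF \<open>countable R\<close> that] unfolding rg_def e_def by metis
  define g where "g a = fn (LEAST n. a \<in> dm n) a" for a
  have g_eq: "g a = fn n a" if "a \<in> dm n" for a n
  proof -
    have "(LEAST n. a \<in> dm n) \<le> n" "a \<in> dm (LEAST n. a \<in> dm n)"
      using that by (auto intro: Least_le LeastI)
    then show ?thesis unfolding g_def using mono by metis
  qed
  have common: "\<exists>n. w \<in> dm n \<and> x \<in> dm n \<and> y \<in> dm n \<and> z \<in> dm n"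
    if W: "w \<in> R" "x \<in> R" "y \<in> R" "z \<in> R" for w x y z
  proof -
    obtain i j k l where "w \<in> dm i" "x \<in> dm j" "y \<in> dm k" "z \<in> dm l" using dm_ex W by metis
    then have "w \<in> dm (max (max i j) (max k l))" "x \<in> dm (max (max i j) (max k l))"
      "y \<in> dm (max (max i j) (max k l))" "z \<in> dm (max (max i j) (max k l))"
      using mono by (meson max.cobounded1 max.cobounded2 order_trans subsetD)+
    then show ?thesis by blast
  qed
  have bij: "bij_betw g R R"
    unfolding bij_betw_def
  proof
    show "inj_on g R"
    proof (rule inj_onI)
      fix x y assume xy: "x \<in> R" "y \<in> R" "g x = g y"
      then obtain n where n: "x \<in> dm n" "y \<in> dm n" using common by blast
      then have "fn n x = fn n y" using g_eq xy by metis
      moreover have "inj_on (fn n) (dm n)" using Qn unfolding DP_iso_def bij_betw_def by blast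
      ultimately show "x = y" using n by (metis inj_onD)
    qed
    show "g ` R = R"
    proof (intro equalityI subsetI)
      fix y assume "y \<in> g ` R"
      then obtain x n where "y = g x" "x \<in> dm n" using dm_ex by blast
      moreover have "fn n ` dm n = rg n" using Qn unfolding DP_iso_def bij_betw_def by blast
      ultimately show "y \<in> R" using g_eq Qn by blast
    next
      fix y assume "y \<in> R"
      then obtain n where "y \<in> rg n" using rg_ex by blast
      moreover have "fn n ` dm n = rg n" using Qn unfolding DP_iso_def bij_betw_def by blast
      ultimately obtain x where "x \<in> dm n" "y = fn n x" by blast
      then have "x \<in> R" "y = g x" using g_eq[of x n] Qn(1) by auto
      then show "y \<in> g ` R" by blast
    qed
  qed
  have "D (g w) (g x) (g y) (g z) \<longleftrightarrow> D w x y z"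
    if W: "w \<in> R" "x \<in> R" "y \<in> R" "z \<in> R" for w x y z
  proof -
    obtain n where n: "w \<in> dm n" "x \<in> dm n" "y \<in> dm n" "z \<in> dm n"
      using common[OF W] by blast
    then show ?thesis using Qn(3)[of n] g_eq unfolding DP_iso_def by metis
  qed
  moreover have "g x \<in> P \<longleftrightarrow> x \<in> P" if "x \<in> R" for x
    using dm_ex[OF that] Qn(3) g_eq unfolding DP_iso_def by metis
  ultimately have "DP_iso D P R R g" using bij unfolding DP_iso_def by blast
  moreover have "g a = f0 a" if "a \<in> A0" for a
    using g_eq[of a 0] s(2) that unfolding dm_def fn_def by simp
  ultimately show ?thesis by blast
qed

context D_structure
begin

text \<open>On quadruples with a repetition \<open>D\<close> is decided by equalities
  (\<open>D_degenerate_iff\<close>), and in the others \<open>x\<close> occurs at most once. The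
  symmetries of \<open>D\<close> move it to the third place, so only relations of that shape have to
  be checked.\<close>

lemma DP_iso_insert:
  assumes iso: "DP_iso D P A B f" and sub: "A \<subseteq> X" "B \<subseteq> X"
    and x: "x \<in> X - A" and y: "y \<in> X - B" and P: "y \<in> P \<longleftrightarrow> x \<in> P"
    and D: "\<And>u v w. u \<in> A \<Longrightarrow> v \<in> A \<Longrightarrow> w \<in> A \<Longrightarrow> D (f u) (f v) y (f w) \<longleftrightarrow> D u v x w"
  shows "DP_iso D P (insert x A) (insert y B) (f(x := y))"
proof -
  define h where "h = f(x := y)"
  have hA: "h a = f a" if "a \<in> A" for a
    using x that unfolding h_def by auto
  have hx: "h x = y" unfolding h_def by simp
  have bij: "bij_betw h (insert x A) (insert y B)"
  proof -
    have "bij_betw h A B"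
      using iso bij_betw_cong[of A f h B] hA unfolding DP_iso_def by auto
    then show ?thesis using bij_betw_combine[of h A B "{x}" "{y}"] x y hx
      by (auto simp: bij_betw_def)
  qed
  have inX: "h u \<in> X" "u \<in> X" if "u \<in> insert x A" for u
    using bij that sub x y unfolding bij_betw_def by auto
  have inj: "h u = h v \<longleftrightarrow> u = v" if "u \<in> insert x A" "v \<in> insert x A" for u v
    using bij that unfolding bij_betw_def by (metis inj_onD)
  have one: "D (h u) (h v) y (h w) \<longleftrightarrow> D u v x w" if "u \<in> A" "v \<in> A" "w \<in> A" for u v w
    using D that hA by auto
  have sym: "D u v w t \<longleftrightarrow> D v u w t" "D u v w t \<longleftrightarrow> D w t u v"
    if "u \<in> X" "v \<in> X" "w \<in> X" "t \<in> X" for u v w t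
    using that by (meson D_swap_left D_swap_sides)+
  have "D (h u) (h v) (h w) (h t) \<longleftrightarrow> D u v w t"
    if W: "u \<in> insert x A" "v \<in> insert x A" "w \<in> insert x A" "t \<in> insert x A" for u v w t
  proof (cases "distinct [u, v, w, t]")
    case False
    then have "\<not> distinct [h u, h v, h w, h t]" by auto
    then show ?thesis
      using D_degenerate_iff[OF False] D_degenerate_iff[of "h u" "h v" "h w" "h t"] inX inj W by auto
  next
    case True
    consider "u = x" "v \<in> A" "w \<in> A" "t \<in> A" | "v = x" "u \<in> A" "w \<in> A" "t \<in> A"
      | "w = x" "u \<in> A" "v \<in> A" "t \<in> A" | "t = x" "u \<in> A" "v \<in> A" "w \<in> A"
      | "u \<in> A" "v \<in> A" "w \<in> A" "t \<in> A"
      using True W by auto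
    then show ?thesis
    proof cases
      case 1
      then show ?thesis using one[of w t v] sym inX[OF W(1)] inX[OF W(2)] inX[OF W(3)] inX[OF W(4)] hx by metis
    next
      case 2
      then show ?thesis using one[of w t u] sym inX[OF W(1)] inX[OF W(2)] inX[OF W(3)] inX[OF W(4)] hx by metis
    next
      case 3
      then show ?thesis using one[of u v t] hx by simp
    next
      case 4
      then show ?thesis using one[of u v w] sym inX[OF W(1)] inX[OF W(2)] inX[OF W(3)] inX[OF W(4)] hx by metis
    next
      case 5
      then show ?thesis using iso hA unfolding DP_iso_def by metis
    qed
  qed
  moreover have "h u \<in> P \<longleftrightarrow> u \<in> P" if "u \<in> insert x A" for u
    using that iso hA hx P unfolding DP_iso_def by auto
  ultimately show ?thesis using bij unfolding DP_iso_def h_def by blast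
qed

text \<open>Here \<open>x\<close> sits inside the edge that separates \<open>A1\<close> from
  \<open>A2\<close>. A pair in \<open>A1\<close> sees \<open>x\<close> in the direction of
  \<open>A2\<close>, hence exactly as it sees \<open>b2\<close>, and vice versa; the path of a mixed
  pair runs past \<open>x\<close>. The right-hand side mentions old points only and is therefore
  transported by isomorphisms.\<close>

lemma type_over_two_classes:
  assumes sub: "A1 \<subseteq> X" "A2 \<subseteq> X" "x \<in> X" and b: "b1 \<in> A1" "b2 \<in> A2"
    and D1: "\<And>u v w. u \<in> A1 \<Longrightarrow> v \<in> A1 \<Longrightarrow> w \<in> A2 \<Longrightarrow> D u v x w"
    and D2: "\<And>u v w. u \<in> A2 \<Longrightarrow> v \<in> A2 \<Longrightarrow> w \<in> A1 \<Longrightarrow> D u v x w"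
    and mem: "u \<in> A1 \<union> A2" "v \<in> A1 \<union> A2" "w \<in> A1 \<union> A2"
  shows "D u v x w \<longleftrightarrow> u \<in> A1 \<and> v \<in> A1 \<and> D u v b2 w \<or> u \<in> A2 \<and> v \<in> A2 \<and> D u v b1 w"
proof -
  have X: "u \<in> X" "v \<in> X" "w \<in> X" "x \<in> X" "b1 \<in> X" "b2 \<in> X" using assms by auto
  have same: "D u v x w \<longleftrightarrow> D u v b w" if "D u v x b" "b \<in> X" for b
    using that X D_trans_right[of u v x b w] D_trans_right[of u v b x w] D_swap_right by blast
  have mixed: "\<not> D u v x w" if "u \<in> A1 \<and> v \<in> A2 \<or> u \<in> A2 \<and> v \<in> A1"
    using that mem D1 D2 X by (metis D_excl D_swap_left D_swap_right Un_iff)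
  have no: "\<not> (r \<in> A1 \<and> r \<in> A2)" for r
    using D1[of r r r] sub D_disjoint by blast
  consider "u \<in> A1" "v \<in> A1" | "u \<in> A2" "v \<in> A2" | "u \<in> A1 \<and> v \<in> A2 \<or> u \<in> A2 \<and> v \<in> A1"
    using mem by blast
  then show ?thesis
  proof cases
    case 1 then show ?thesis using same[OF D1[OF 1 b(2)]] X no by blast
  next
    case 2 then show ?thesis using same[OF D2[OF 2 b(1)]] X no by blast
  next
    case 3 then show ?thesis using mixed no by blast
  qed
qed

end

context D_triple
begin

text \<open>Here \<open>x\<close> lies in a sector free of old points. Points \<open>u, v\<close> of
  one sector are separated from \<open>x\<close> and \<open>t\<close> together, so \<open>x\<close>
  may be exchanged for the old point \<open>t\<close>.\<close>

lemma type_over_node: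
  assumes X: "x \<in> X" "t \<in> X" "u \<in> X" "v \<in> X" "w \<in> X" and S: "\<not> S u t" "\<not> S x u" "\<not> S x w"
  shows "D u v x w \<longleftrightarrow> S u v \<and> D u v t w"
proof
  assume D: "D u v x w"
  then have uv: "S u v" using co_sector_of_separated[of u v x w] X S by blast
  moreover have "D u v t x"
    using separated_of_co_sector[OF uv S(1)] S X co_sector_sym by blast
  ultimately show "S u v \<and> D u v t w" using D D_trans_right X by blast
next
  assume *: "S u v \<and> D u v t w"
  then have "D u v x t"
    using separated_of_co_sector[of u v x t] S X co_sector_sym by blast
  then show "D u v x w" using * D_trans_right X by blast
qed

end

context D_structure
begin

text \<open>If \<open>f\<close> mapped \<open>A\<close> onto a set meeting all sectors at the image
  node, that node would have finitely many, exactly as many as \<open>A\<close> meets at the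
  original node. By constant valency \<open>A\<close> would then meet every sector there, including
  the one of \<open>x\<close>.\<close>

lemma exists_free_sector:
  assumes val: "same_node_valency X D" and sub: "A \<subseteq> X" "B \<subseteq> X" and fin: "finite A"
    and iso: "DP_iso D C A B f" and abc: "a \<in> A" "b \<in> A" "c \<in> A" "D_triple X D a b c"
    and x: "x \<in> X" "\<And>u. u \<in> A \<Longrightarrow> \<not> co_sector D a b c x u"
  shows "D_triple X D (f a) (f b) (f c)"
    and "\<exists>y\<in>X. \<forall>u\<in>A. \<not> co_sector D (f a) (f b) (f c) y (f u)"
proof -
  interpret T: D_triple X D a b c by (rule abc)
  have fX: "f u \<in> X" if "u \<in> A" for u
    using iso sub that unfolding DP_iso_def bij_betw_def by blast
  have inj: "inj_on f A" using iso unfolding DP_iso_def bij_betw_def by blast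
  show tr: "D_triple X D (f a) (f b) (f c)"
    using abc fX T.triple_distinct inj_onD[OF inj]
    by (unfold_locales) blast+
  then interpret T': D_triple X D "f a" "f b" "f c" .
  have S_iff: "T'.S (f u) (f v) \<longleftrightarrow> T.S u v" if "u \<in> A" "v \<in> A" for u v
    using iso that abc unfolding co_sector_def DP_iso_def by metis
  define N where "N = node_at X D a b c"
  define M where "M = node_at X D (f a) (f b) (f c)"
  define h where "h u = {w \<in> X. T.S u w}" for u
  define k where "k u = {w \<in> X. T'.S u w}" for u
  have hk: "h u = h v \<longleftrightarrow> k (f u) = k (f v)" if "u \<in> A" "v \<in> A" for u v
    unfolding h_def k_def
    using T.node_at_eq_iff[of u v] T'.node_at_eq_iff[of "f u" "f v"] S_iff[OF that] that fX sub by auto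
  show "\<exists>y\<in>X. \<forall>u\<in>A. \<not> T'.S y (f u)"
  proof (rule ccontr)
    assume "\<not> ?thesis"
    then have all: "\<exists>u\<in>A. T'.S y (f u)" if "y \<in> X" for y using that by blast
    have M: "M = (\<lambda>u. k (f u)) ` A"
    proof -
      have "k y \<in> (\<lambda>u. k (f u)) ` A" if y: "y \<in> X" for y
      proof -
        obtain u where "u \<in> A" "T'.S y (f u)" using all[OF y] by blast
        then have "k y = k (f u)" unfolding k_def using T'.node_at_eq_iff[of y "f u"] fX y by blast
        then show ?thesis using \<open>u \<in> A\<close> by blast
      qed
      then show ?thesis unfolding M_def node_at_def k_def[symmetric] using fX by blast
    qed
    have "(\<lambda>u. k (f u)) ` A \<approx> h ` A"
    proof -
      \<comment> \<open>Any point of \<open>A\<close> representing the image sector \<open>Y\<close>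
        may be chosen, because by \<open>hk\<close> all of them lie in the same sector at the
        original node.\<close>
      have "bij_betw (\<lambda>Y. h (SOME u. u \<in> A \<and> k (f u) = Y)) ((\<lambda>u. k (f u)) ` A) (h ` A)"
      proof -
        have some: "h (SOME v. v \<in> A \<and> k (f v) = k (f u)) = h u" if "u \<in> A" for u
          using someI[of "\<lambda>v. v \<in> A \<and> k (f v) = k (f u)" u] that hk by blast
        show ?thesis
          unfolding bij_betw_def
        proof
          show "inj_on (\<lambda>Y. h (SOME u. u \<in> A \<and> k (f u) = Y)) ((\<lambda>u. k (f u)) ` A)"
            using some hk by (auto simp: inj_on_def)
          show "(\<lambda>Y. h (SOME u. u \<in> A \<and> k (f u) = Y)) ` (\<lambda>u. k (f u)) ` A = h ` A"
            using some by (auto simp: image_image)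
        qed
      qed
      then show ?thesis unfolding eqpoll_def by blast
    qed
    moreover have "N \<approx> M"
      using val T.node_splitting_node_at T'.node_splitting_node_at
      unfolding same_node_valency_def N_def M_def by blast
    ultimately have eq: "N \<approx> h ` A" unfolding M by (rule eqpoll_trans[rotated])
    then have "finite N" using fin eqpoll_finite_iff by blast
    have "h ` A \<subseteq> N" unfolding N_def node_at_def h_def using sub by blast
    moreover have "card N = card (h ` A)" using eq fin \<open>finite N\<close> eqpoll_iff_card by blast
    ultimately have "h ` A = N" using \<open>finite N\<close> card_subset_eq by metis
    moreover have "h x \<in> N" unfolding N_def node_at_def h_def using x by blast
    ultimately obtain u where u: "u \<in> A" "h x = h u" by blast
    then have "T.S x u" unfolding h_def using T.node_at_eq_iff[of x u] x sub by blast
    then show False using x u by blast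
  qed
qed

text \<open>Density speaks of single quadruples. The nearest pairs \<open>a, b\<close> and
  \<open>c, d\<close> mark the two ends of the edge between \<open>A1\<close> and \<open>A2\<close>,
  so a midpoint for this one quadruple lies between the whole sets.\<close>

lemma dense_between:
  assumes dense: "D_dense X D" and fin: "finite A1" "finite A2" and sub: "A1 \<subseteq> X" "A2 \<subseteq> X"
    and ne: "A1 \<noteq> {}" "A2 \<noteq> {}"
    and D: "\<And>u v w z. u \<in> A1 \<Longrightarrow> v \<in> A1 \<Longrightarrow> w \<in> A2 \<Longrightarrow> z \<in> A2 \<Longrightarrow> D u v w z"
  obtains y where "y \<in> X"
    "\<And>u v w. u \<in> A1 \<Longrightarrow> v \<in> A1 \<Longrightarrow> w \<in> A2 \<Longrightarrow> D u v y w"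
    "\<And>u v w. u \<in> A2 \<Longrightarrow> v \<in> A2 \<Longrightarrow> w \<in> A1 \<Longrightarrow> D u v y w"
proof -
  have no: "\<not> (r \<in> A1 \<and> r \<in> A2)" for r
    using D[of r r r r] sub D_disjoint by blast
  obtain r1 r2 where r: "r1 \<in> A1" "r2 \<in> A2" using ne by blast
  obtain a b where ab: "a \<in> A1" "b \<in> A1" "\<And>s. s \<in> A1 \<Longrightarrow> \<not> D a b s r2"
    using exists_nearest_pair[of A1 r2] fin ne sub r no by blast
  obtain c d where cd: "c \<in> A2" "d \<in> A2" "\<And>s. s \<in> A2 \<Longrightarrow> \<not> D c d s r1"
    using exists_nearest_pair[of A2 r1] fin ne sub r no by blast
  have X: "a \<in> X" "b \<in> X" "c \<in> X" "d \<in> X" "r1 \<in> X" "r2 \<in> X" using ab cd r sub by auto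
  have "D a b c d" using D ab cd by blast
  then obtain y where y: "y \<in> X" "D y b c d" "D a y c d" "D a b y d" "D a b c y"
    using dense X unfolding D_dense_def by metis
  have half: "D u v y w"
    if "\<And>s. s \<in> F \<Longrightarrow> \<not> D a b s r" "F \<subseteq> X" "G \<subseteq> X" "r \<in> G" "a \<in> F" "b \<in> F" "d \<in> G"
      "\<And>u v w z. u \<in> F \<Longrightarrow> v \<in> F \<Longrightarrow> w \<in> G \<Longrightarrow> z \<in> G \<Longrightarrow> D u v w z" "D a b y d"
      "u \<in> F" "v \<in> F" "w \<in> G" for a b d r F G u v w
  proof -
    have X: "a \<in> X" "b \<in> X" "d \<in> X" "r \<in> X" "u \<in> X" "v \<in> X" "w \<in> X" using that by auto
    have near: "D s b d y" if "s \<in> F" for s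
    proof -
      have sX: "s \<in> X" using that \<open>F \<subseteq> X\<close> by blast
      have "D a b d r" using \<open>a \<in> F\<close> \<open>b \<in> F\<close> \<open>d \<in> G\<close> \<open>r \<in> G\<close> \<open>\<And>u v w z. u \<in> F \<Longrightarrow> v \<in> F \<Longrightarrow> w \<in> G \<Longrightarrow> z \<in> G \<Longrightarrow> D u v w z\<close> by blast
      then have "\<not> D a b d s"
        using \<open>\<And>s. s \<in> F \<Longrightarrow> \<not> D a b s r\<close>[OF that] D_trans_right[of a b s d r] D_swap_right X sX by blast
      then show ?thesis using D_either[of a b d y s] D_swap_right[OF \<open>D a b y d\<close>] X sX y(1) by blast
    qed
    have "D u v d y"
      using near[OF \<open>u \<in> F\<close>] near[OF \<open>v \<in> F\<close>] D_trans[of u b d y v] D_swap_left X y(1) by blast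
    moreover have "D u v d w" using that by blast
    ultimately show ?thesis using D_trans_right[of u v y d w] D_swap_right X y(1) by blast
  qed
  have D': "D u v w z" if "u \<in> A2" "v \<in> A2" "w \<in> A1" "z \<in> A1" for u v w z
    using D[OF that(3,4,1,2)] that sub D_swap_sides by blast
  have y': "D c d y b" using y X by (meson D_swap_left D_swap_right D_swap_sides)
  show ?thesis
  proof (rule that[OF y(1)])
    show "D u v y w" if "u \<in> A1" "v \<in> A1" "w \<in> A2" for u v w
      using half[of A1 a b r2 A2 d u v w, OF ab(3) sub r(2) ab(1,2) cd(2) D y(4) that] by simp
    show "D u v y w" if "u \<in> A2" "v \<in> A2" "w \<in> A1" for u v w
      using half[of A2 c d r1 A1 b u v w, OF cd(3) sub(2,1) r(1) cd(1,2) ab(2) D' y' that] by simp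
  qed
qed

text \<open>A point \<open>y0\<close> of the right type is found first, regardless of colour. The
  cone of \<open>y0\<close> against \<open>f a, f b\<close> consists of points attached at the same
  place as \<open>y0\<close>, and the colour hypothesis picks \<open>y\<close> there.\<close>

lemma one_point_extension:
  assumes dense: "D_dense X D" and val: "same_node_valency X D"
    and col: "\<And>a b c x. a \<in> X \<Longrightarrow> b \<in> X \<Longrightarrow> c \<in> X \<Longrightarrow> distinct [a, b, c] \<Longrightarrow> x \<in> X \<Longrightarrow>
      \<exists>y\<in>X. D y c a b \<and> (y \<in> C \<longleftrightarrow> x \<in> C)"
    and fin: "finite A" and two: "2 \<le> card A" and sub: "A \<subseteq> X" "B \<subseteq> X"
    and iso: "DP_iso D C A B f" and x: "x \<in> X - A"
  shows "\<exists>y\<in>X. DP_iso D C (insert x A) (insert y B) (f(x := y))"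
proof -
  have fX: "f u \<in> X" if "u \<in> A" for u
    using iso sub that unfolding DP_iso_def bij_betw_def by blast
  have fD: "D (f u) (f v) (f w) (f z) \<longleftrightarrow> D u v w z" if "u \<in> A" "v \<in> A" "w \<in> A" "z \<in> A" for u v w z
    using iso that unfolding DP_iso_def by blast
  have B: "B = f ` A" using iso unfolding DP_iso_def bij_betw_def by blast
  have inj: "inj_on f A" using iso unfolding DP_iso_def bij_betw_def by blast
  have other: "\<exists>v\<in>A. v \<noteq> u" for u
    using two fin by (metis card_le_Suc0_iff_eq not_less_eq_eq numeral_2_eq_2)
  have finish: "\<exists>y\<in>X. DP_iso D C (insert x A) (insert y B) (f(x := y))"
    if "y \<in> X" "y \<in> C \<longleftrightarrow> x \<in> C"
      "\<And>u v w. u \<in> A \<Longrightarrow> v \<in> A \<Longrightarrow> w \<in> A \<Longrightarrow> D (f u) (f v) y (f w) \<longleftrightarrow> D u v x w" for y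
  proof -
    have "y \<noteq> f u" if "u \<in> A" for u
    proof -
      obtain v where "v \<in> A" "v \<noteq> u" using other by blast
      then have "D u u x v" using D_point_left x sub that by (metis DiffD1 DiffD2 subsetD)
      then have "D (f u) (f u) y (f v)" using that \<open>v \<in> A\<close> \<open>\<And>u v w. _ \<Longrightarrow> _ \<Longrightarrow> _ \<Longrightarrow> D (f u) (f v) y (f w) \<longleftrightarrow> D u v x w\<close> by blast
      then show ?thesis using D_disjoint fX \<open>v \<in> A\<close> that \<open>y \<in> X\<close> by blast
    qed
    then show ?thesis using DP_iso_insert[OF iso sub x _ that(2,3)] that(1) B by blast
  qed
  \<comment> \<open>The classes of \<open>R\<close> are the pieces into which the tree of
    \<open>A\<close> falls when the place where \<open>x\<close> attaches is removed. Three or more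
    classes mean that \<open>x\<close> attaches at a node, two that it attaches inside an
    edge.\<close>
  define R where "R u v \<longleftrightarrow> (\<exists>c\<in>A. D u v x c)" for u v
  have R_refl: "R u u" if "u \<in> A" for u
    using other[of u] D_point_left x sub that unfolding R_def by (metis DiffD1 DiffD2 subsetD)
  have R_sym: "R v u" if "R u v" "u \<in> A" "v \<in> A" for u v
    using that D_swap_left x sub unfolding R_def by (metis DiffD1 subsetD)
  have R_trans: "R u w" if R: "R u v" "R v w" "u \<in> A" "v \<in> A" "w \<in> A" for u v w
  proof -
    obtain c d where cd: "c \<in> A" "d \<in> A" "D u v x c" "D v w x d" using R unfolding R_def by blast
    have X: "u \<in> X" "v \<in> X" "w \<in> X" "c \<in> X" "d \<in> X" "x \<in> X" using R cd x sub by auto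
    have "D u w c x \<or> D u w x d"
      using D_trans_overlap[of u v c x w d] D_swap_right[OF cd(3)] cd X by blast
    then show ?thesis using cd D_swap_right X unfolding R_def by blast
  qed
  have sep: "D u v x w" if R: "R u v" "\<not> R u w" "u \<in> A" "v \<in> A" "w \<in> A" for u v w
  proof -
    obtain c where c: "c \<in> A" "D u v x c" using R unfolding R_def by blast
    have X: "u \<in> X" "v \<in> X" "w \<in> X" "c \<in> X" "x \<in> X" using that c x sub by auto
    have "\<not> D w v x c" using that c R_trans R_sym unfolding R_def by blast
    then show ?thesis using D_either[of u v x c w] c X by blast
  qed
  \<comment> \<open>A pair nearest to \<open>x\<close> is not separated from \<open>x\<close>
    together with any point of \<open>A\<close>, so there are at least two classes.\<close>
  have "\<exists>a\<in>A. \<exists>b\<in>A. \<forall>s\<in>A. \<not> D a b s x"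
    using exists_nearest_pair[of A x] fin other[of x] sub x by blast
  then obtain a b where ab: "a \<in> A" "b \<in> A" "\<not> R a b"
    unfolding R_def using D_swap_right x sub by (metis DiffD1 subsetD)
  show ?thesis
  proof (cases "\<exists>c\<in>A. \<not> R a c \<and> \<not> R b c")
    case True
    then obtain c where c: "c \<in> A" "\<not> R a c" "\<not> R b c" by blast
    have X: "a \<in> X" "b \<in> X" "c \<in> X" using ab c sub by auto
    have tr: "D_triple X D a b c"
      using ab c R_refl X by unfold_locales auto
    interpret T: D_triple X D a b c by (rule tr)
    have xS: "\<not> T.S x u" if "u \<in> A" for u
    proof
      assume "T.S x u"
      then have "D a b x u \<or> D b c x u \<or> D a c x u"
        unfolding co_sector_def using D_swap_sides X x sub that by blast
      then show False using ab c that unfolding R_def by blast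
    qed
    have xX: "x \<in> X" using x by blast
    note free = exists_free_sector[OF val sub fin iso ab(1,2) c(1) tr xX xS]
    interpret T': D_triple X D "f a" "f b" "f c" by (rule free(1))
    obtain y0 where y0: "y0 \<in> X" "\<And>u. u \<in> A \<Longrightarrow> \<not> T'.S y0 (f u)" using free(2) by blast
    have "y0 \<noteq> f a" "y0 \<noteq> f b" using y0 ab T'.co_sector_refl by metis+
    then obtain y where y: "y \<in> X" "D y y0 (f a) (f b)" "y \<in> C \<longleftrightarrow> x \<in> C"
      using col[of "f a" "f b" y0 x] T'.in_X T'.triple_distinct y0 x by auto
    have yS: "\<not> T'.S y (f u)" if "u \<in> A" for u
    proof -
      have "T'.S y0 y" using y y0(1) T'.in_X D_swap_left unfolding co_sector_def by blast
      then show ?thesis using y0 T'.co_sector_trans y(1) fX that by blast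
    qed
    have S_iff: "T'.S (f u) (f v) \<longleftrightarrow> T.S u v" if "u \<in> A" "v \<in> A" for u v
      using fD that ab c unfolding co_sector_def by metis
    show ?thesis
    proof (rule finish[OF y(1,3)])
      fix u v w assume uvw: "u \<in> A" "v \<in> A" "w \<in> A"
      \<comment> \<open>The old point by which \<open>type_over_node\<close> replaces
        \<open>x\<close>: since \<open>a\<close> and \<open>b\<close> lie in different sectors, one
        of them avoids the sector of \<open>u\<close>.\<close>
      have "\<exists>t\<in>A. \<not> T.S u t"
        using ab(1,2) uvw T.triple_not_co_sector(1) T.co_sector_trans[of a u b] T.co_sector_sym[of u a] sub
        by blast
      then obtain t where t: "t \<in> A" "\<not> T.S u t" by blast
      have mem: "u \<in> X" "v \<in> X" "w \<in> X" "t \<in> X" using uvw t sub by auto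
      have "D u v x w \<longleftrightarrow> T.S u v \<and> D u v t w"
        using T.type_over_node[of x t u v w] mem xX t xS uvw by blast
      also have "\<dots> \<longleftrightarrow> T'.S (f u) (f v) \<and> D (f u) (f v) (f t) (f w)"
        using S_iff fD uvw t by blast
      also have "\<dots> \<longleftrightarrow> D (f u) (f v) y (f w)"
        using T'.type_over_node[of y "f t" "f u" "f v" "f w"] fX uvw t S_iff yS y(1) by blast
      finally show "D (f u) (f v) y (f w) \<longleftrightarrow> D u v x w" by blast
    qed
  next
    case False
    define A1 where "A1 = {u \<in> A. R a u}"
    define A2 where "A2 = {u \<in> A. R b u}"
    have cover: "A = A1 \<union> A2" using False unfolding A1_def A2_def by blast
    have ne: "a \<in> A1" "b \<in> A2" using ab R_refl unfolding A1_def A2_def by auto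
    have R1: "R u v" if "u \<in> A1" "v \<in> A1" for u v
      using that ab R_sym[of a u] R_trans[of u a v] unfolding A1_def by blast
    have R2: "R u v" if "u \<in> A2" "v \<in> A2" for u v
      using that ab R_sym[of b u] R_trans[of u b v] unfolding A2_def by blast
    have R12: "\<not> R u v" "\<not> R v u" if uv: "u \<in> A1" "v \<in> A2" for u v
    proof -
      have "u \<in> A" "v \<in> A" "R a u" "R v b" using uv ab R_sym unfolding A1_def A2_def by auto
      then show "\<not> R u v" "\<not> R v u" using ab R_trans[of a u v] R_trans[of a v b] R_sym[of v u] by blast+
    qed
    have inA: "A1 \<subseteq> A" "A2 \<subseteq> A" unfolding A1_def A2_def by auto
    have D1: "D u v x w" if "u \<in> A1" "v \<in> A1" "w \<in> A2" for u v w
      using sep[of u v w] R1 R12 that inA by blast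
    have D2: "D u v x w" if "u \<in> A2" "v \<in> A2" "w \<in> A1" for u v w
      using sep[of u v w] R2 R12 that inA by blast
    have D12: "D u v w z" if "u \<in> A1" "v \<in> A1" "w \<in> A2" "z \<in> A2" for u v w z
    proof -
      have "u \<in> X" "v \<in> X" "w \<in> X" "z \<in> X" "x \<in> X" using that inA sub x by auto
      then show ?thesis
        using D1[OF that(1,2,3)] D1[OF that(1,2,4)] D_trans_right[of u v w x z] D_swap_right by blast
    qed
    have fin': "finite (f ` A1)" "finite (f ` A2)"
      using finite_subset[OF inA(1) fin] finite_subset[OF inA(2) fin] by auto
    have sub': "f ` A1 \<subseteq> X" "f ` A2 \<subseteq> X" using fX inA by auto
    have fD12: "D u v w z" if "u \<in> f ` A1" "v \<in> f ` A1" "w \<in> f ` A2" "z \<in> f ` A2" for u v w z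
      using that D12 fD inA by (auto simp: subset_iff)
    obtain y0 where y0: "y0 \<in> X"
      "\<And>u v w. u \<in> f ` A1 \<Longrightarrow> v \<in> f ` A1 \<Longrightarrow> w \<in> f ` A2 \<Longrightarrow> D u v y0 w"
      "\<And>u v w. u \<in> f ` A2 \<Longrightarrow> v \<in> f ` A2 \<Longrightarrow> w \<in> f ` A1 \<Longrightarrow> D u v y0 w"
      using dense_between[OF dense fin' sub' _ _ fD12] ne by blast
    have fab: "f a \<in> X" "f b \<in> X" "f a \<noteq> f b" "y0 \<noteq> f a" "y0 \<noteq> f b"
      using fX ab fD12[of "f a" "f a" "f b" "f b"] y0(2)[of "f a" "f a" "f b"]
        y0(3)[of "f b" "f b" "f a"] ne D_disjoint[of "f a" "f a" "f b" "f b"]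
        D_disjoint[of "f a" "f a" y0 "f b"] D_disjoint[of "f b" "f b" y0 "f a"] y0(1)
      by auto
    then obtain y where y: "y \<in> X" "D y y0 (f a) (f b)" "y \<in> C \<longleftrightarrow> x \<in> C"
      using col[of "f a" "f b" y0 x] y0(1) x by auto
    \<comment> \<open>If a relation with \<open>y0\<close> did not pass to \<open>y\<close>,
      \<open>D_either\<close> would give \<open>D y p q y0\<close>, against
      \<open>D y y0 p q\<close>.\<close>
    have move: "D u v y w"
      if "D u p y0 q" "D v p y0 q" "D y y0 p q" "{u, v, w, p, q} \<subseteq> X" "D u v w q" for u v w p q
    proof -
      have X: "u \<in> X" "v \<in> X" "w \<in> X" "p \<in> X" "q \<in> X" "y \<in> X" "y0 \<in> X" using that y y0 by auto
      have up: "D t p y q" if "D t p y0 q" "t \<in> X" for t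
      proof -
        have "D t p q y \<or> D y p q y0" using D_either[of t p q y0 y] D_swap_right that X by blast
        moreover have "\<not> D y p q y0" using \<open>D y y0 p q\<close> X by (meson D_excl D_swap_right)
        ultimately show ?thesis using D_swap_right X that by blast
      qed
      have "D u v y q"
        using up[of u] up[of v] D_trans[of u p y q v] D_swap_left that X by blast
      then show ?thesis using D_trans_right[of u v y q w] D_swap_right[OF \<open>D u v w q\<close>] X by blast
    qed
    have fa: "f a \<in> f ` A1" and fb: "f b \<in> f ` A2" using ne by auto
    have fD21: "D u v w z" if "u \<in> f ` A2" "v \<in> f ` A2" "w \<in> f ` A1" "z \<in> f ` A1" for u v w z
      by (rule D_swap_sides[OF fD12[OF that(3,4,1,2)]]) (use that sub' in blast)+
    have y_swap: "D y y0 (f b) (f a)"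
      by (rule D_swap_right[OF y(2) y(1) y0(1) fab(1,2)])
    have yD1: "D u v y w" if "u \<in> f ` A1" "v \<in> f ` A1" "w \<in> f ` A2" for u v w
    proof (rule move[OF y0(2)[OF that(1) fa fb] y0(2)[OF that(2) fa fb] y(2) _ fD12[OF that fb]])
      show "{u, v, w, f a, f b} \<subseteq> X" using that sub' fab(1,2) by blast
    qed
    have yD2: "D u v y w" if "u \<in> f ` A2" "v \<in> f ` A2" "w \<in> f ` A1" for u v w
    proof (rule move[OF y0(3)[OF that(1) fb fa] y0(3)[OF that(2) fb fa] y_swap _ fD21[OF that fa]])
      show "{u, v, w, f b, f a} \<subseteq> X" using that sub' fab(1,2) by blast
    qed
    show ?thesis
    proof (rule finish[OF y(1,3)])
      fix u v w assume uvw: "u \<in> A" "v \<in> A" "w \<in> A"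
      have memf: "f u \<in> f ` A1 \<longleftrightarrow> u \<in> A1" "f u \<in> f ` A2 \<longleftrightarrow> u \<in> A2" if "u \<in> A" for u
        using inj_on_image_mem_iff[OF inj that inA(1)] inj_on_image_mem_iff[OF inj that inA(2)] by auto
      have sub1: "A1 \<subseteq> X" "A2 \<subseteq> X" "x \<in> X" using inA sub x by auto
      have mem: "u \<in> A1 \<union> A2" "v \<in> A1 \<union> A2" "w \<in> A1 \<union> A2" using uvw cover by auto
      have fmem: "f u \<in> f ` A1 \<union> f ` A2" "f v \<in> f ` A1 \<union> f ` A2" "f w \<in> f ` A1 \<union> f ` A2"
        using mem by auto
      have "D u v x w \<longleftrightarrow> u \<in> A1 \<and> v \<in> A1 \<and> D u v b w \<or> u \<in> A2 \<and> v \<in> A2 \<and> D u v a w"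
        by (rule type_over_two_classes[OF sub1 ne D1 D2 mem])
      also have "\<dots> \<longleftrightarrow> f u \<in> f ` A1 \<and> f v \<in> f ` A1 \<and> D (f u) (f v) (f b) (f w) \<or>
          f u \<in> f ` A2 \<and> f v \<in> f ` A2 \<and> D (f u) (f v) (f a) (f w)"
        unfolding memf[OF uvw(1)] memf[OF uvw(2)] fD[OF uvw(1,2) ab(1) uvw(3)]
          fD[OF uvw(1,2) ab(2) uvw(3)] ..
      also have "\<dots> \<longleftrightarrow> D (f u) (f v) y (f w)"
        by (rule type_over_two_classes[OF sub' y(1) fa fb yD1 yD2 fmem, symmetric])
      finally show "D (f u) (f v) y (f w) \<longleftrightarrow> D u v x w" by blast
    qed
  qed
qed

text \<open>For \<open>C = {}\<close> the colour hypothesis is met by \<open>y = c\<close>, and the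
  statement becomes uncoloured homogeneity.\<close>

theorem homogeneous_extension:
  assumes "countable X" "D_dense X D" "same_node_valency X D"
    and "\<And>a b c x. a \<in> X \<Longrightarrow> b \<in> X \<Longrightarrow> c \<in> X \<Longrightarrow> distinct [a, b, c] \<Longrightarrow> x \<in> X \<Longrightarrow>
      \<exists>y\<in>X. D y c a b \<and> (y \<in> C \<longleftrightarrow> x \<in> C)"
    and "finite A" "2 \<le> card A" "A \<subseteq> X" "B \<subseteq> X" "DP_iso D C A B f"
  shows "\<exists>g. DP_iso D C X X g \<and> (\<forall>a\<in>A. g a = f a)"
  using back_and_forth[OF assms(1) _ assms(5-9)] one_point_extension[OF assms(2-4)] by blast

section \<open>Substructures, cones and transfer of valency\<close>

lemma D_structure_subset:
  assumes "Y \<subseteq> X"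
  shows "D_structure Y D"
  unfolding D_structure_def D_set_def
proof (intro ballI)
  fix w x y z assume "w \<in> Y" "x \<in> Y" "y \<in> Y" "z \<in> Y"
  then have mem: "w \<in> X" "x \<in> X" "y \<in> X" "z \<in> X" using assms by auto
  have "D v x y z \<or> D w x y v" if "D w x y z" "v \<in> Y" for v
    using D_either[OF that(1) mem] that(2) assms by blast
  then show "(D w x y z \<longrightarrow> D x w y z \<and> D y z w x) \<and> (D w x y z \<longrightarrow> \<not> D w y x z) \<and>
      (D w x y z \<longrightarrow> (\<forall>v\<in>Y. D v x y z \<or> D w x y v)) \<and> (w \<noteq> y \<and> x \<noteq> y \<longrightarrow> D w x y y)"
    using D_swap_left[OF _ mem] D_swap_sides[OF _ mem] D_excl[OF _ mem] D_point[OF _ _ mem(1-3)]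
    by blast
qed

text \<open>If the cone were finite, one could take a pair nearest to \<open>c\<close> among its
  other points together with \<open>a\<close>. Properness yields a point branching off still nearer
  to \<open>c\<close>; it belongs to the cone, against the choice of the pair.\<close>

lemma infinite_cone:
  assumes proper: "D_proper X D" and abc: "a \<in> X" "b \<in> X" "c \<in> X" "distinct [a, b, c]"
  shows "infinite {u \<in> X. D u c a b}"
proof
  define K where "K = {u \<in> X. D u c a b}"
  assume "finite {u \<in> X. D u c a b}"
  then have "finite K" unfolding K_def .
  have closer: "\<exists>z\<in>X. z \<noteq> y \<and> D w x y z" if "w \<in> X" "x \<in> X" "y \<in> X" "distinct [w, x, y]" for w x y
    using proper that unfolding D_proper_def by auto
  \<comment> \<open>Adding \<open>a\<close> gives \<open>F\<close> at least two points, the other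
    being \<open>z0\<close>. The nearest pair then consists of distinct points, to which properness
    applies.\<close>
  define F where "F = insert a (K - {c})"
  have F: "finite F" "F \<noteq> {}" "F \<subseteq> X" "c \<notin> F"
    unfolding F_def using \<open>finite K\<close> abc unfolding K_def by auto
  obtain u v where uv: "u \<in> F" "v \<in> F" "\<And>s. s \<in> F \<Longrightarrow> \<not> D u v s c"
    using exists_nearest_pair[OF F(1,2,3) abc(3) F(4)] by blast
  have X: "u \<in> X" "v \<in> X" "u \<noteq> c" "v \<noteq> c" using uv F by auto
  obtain z0 where z0: "z0 \<in> X" "z0 \<noteq> c" "D a b c z0" using closer[of a b c] abc by auto
  have "z0 \<in> K" unfolding K_def using z0 abc D_swap_sides D_swap_left by blast
  then have z0F: "z0 \<in> F" using z0 unfolding F_def by blast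
  have "z0 \<noteq> a" using z0 D_disjoint abc by blast
  have "u \<noteq> v"
  proof
    assume "u = v"
    obtain s where "s \<in> F" "s \<noteq> u" using z0F \<open>z0 \<noteq> a\<close> unfolding F_def by blast
    then show False using uv \<open>u = v\<close> D_point_left[of u s c] X F abc by blast
  qed
  then obtain z where z: "z \<in> X" "z \<noteq> c" "D u v c z" using closer[of u v c] X abc by auto
  \<comment> \<open>A point nearer to \<open>c\<close> than a member \<open>k\<close> of the cone,
    as seen from \<open>a\<close>, is in the cone: otherwise \<open>D_either\<close> gives
    \<open>D b c a k\<close>, which crosses \<open>D k c a b\<close>.\<close>
  have K_of: "z \<in> K" if "D z c a k" "k \<in> K" for k
  proof -
    have k: "k \<in> X" "D k c a b" using that unfolding K_def by auto
    have "D z c a b \<or> D b c a k" using D_either[of z c a k b] that k z abc by blast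
    moreover have "\<not> D b c a k"
      using D_excl[of c k b a] k abc by (meson D_swap_left D_swap_right)
    ultimately show ?thesis using z unfolding K_def by blast
  qed
  have zc: "D z c u v" using z X abc by (meson D_swap_left D_swap_right D_swap_sides)
  have "z \<in> K"
  proof (cases "u = a \<or> v = a")
    case True
    then show ?thesis
      using K_of[of u] K_of[of v] zc uv \<open>u \<noteq> v\<close> D_swap_right X z(1) abc(3) unfolding F_def by blast
  next
    case False
    then have "u \<in> K" "\<not> D u v a c" using uv unfolding F_def by auto
    have "D z c u a \<or> D a c u v" using D_either[of z c u v a] zc X z(1) abc by blast
    then have "D z c u a" using \<open>\<not> D u v a c\<close> D_swap_sides X abc by blast
    then show ?thesis using K_of[of u] \<open>u \<in> K\<close> D_swap_right X z(1) abc by blast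
  qed
  then have "z \<in> F" using z unfolding F_def by blast
  then show False using uv(3)[of z] z X abc D_swap_right by blast
qed

text \<open>Intersecting the sectors with \<open>Y\<close> turns a node splitting of
  \<open>X\<close> into one of \<open>Y\<close>. No sectors are lost or identified because each of
  them meets \<open>Y\<close>.\<close>

lemma same_node_valency_superset:
  assumes sub: "Y \<subseteq> X" and val: "same_node_valency Y D"
    and meets: "\<And>a b c. a \<in> X \<Longrightarrow> b \<in> X \<Longrightarrow> c \<in> X \<Longrightarrow> distinct [a, b, c] \<Longrightarrow> \<exists>y\<in>Y. D y c a b"
  shows "same_node_valency X D"
proof -
  have restrict: "node_splitting Y D ((\<lambda>\<Sigma>. \<Sigma> \<inter> Y) ` S)" "S \<approx> (\<lambda>\<Sigma>. \<Sigma> \<inter> Y) ` S"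
    if S: "node_splitting X D S" for S
  proof -
    have sp: "splitting X D S" and big: "infinite S \<or> 2 < card S"
      using S unfolding node_splitting_def by auto
    note uniq = splitting_sector_unique[OF sp]
    \<comment> \<open>For \<open>s\<close> in the sector and \<open>u, v\<close> in two others, a
      point separated together with \<open>s\<close> from \<open>u, v\<close> lies in the sector of
      \<open>s\<close> by \<open>splitting_separates\<close>; \<open>meets\<close> supplies such a
      point in \<open>Y\<close>.\<close>
    have nonempty: "\<Sigma> \<inter> Y \<noteq> {}" if mS: "\<Sigma> \<in> S" for \<Sigma>
    proof -
      obtain A B C a b c where abc: "A \<in> S" "B \<in> S" "C \<in> S" "distinct [A, B, C]" "a \<in> A" "b \<in> B" "c \<in> C"
        by (rule node_splitting_obtains[OF S])
      obtain s where s: "s \<in> \<Sigma>" using splitting_partition[OF sp] mS unfolding partition_on_def by fastforce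
      have "\<exists>U\<in>S. \<exists>V\<in>S. \<exists>u\<in>U. \<exists>v\<in>V. distinct [U, V, \<Sigma>]"
        using abc by (metis distinct_length_2_or_more distinct_singleton)
      then obtain U V u v where uv: "U \<in> S" "V \<in> S" "u \<in> U" "v \<in> V" "distinct [U, V, \<Sigma>]" by blast
      have mem: "u \<in> X" "v \<in> X" "s \<in> X" using uv s that splitting_subset[OF sp] by auto
      have "distinct [u, v, s]" using uniq uv s that by auto
      then obtain y where y: "y \<in> Y" "D y s u v" using meets[of u v s] mem by blast
      have "\<exists>\<Sigma>'\<in>S. y \<in> \<Sigma>' \<and> s \<in> \<Sigma>'"
        using splitting_separates[OF sp uv(1,2) _ uv(3,4) y(2)] uv(5) y(1) sub mem by auto
      then show ?thesis using uniq s that y by blast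
    qed
    have inj: "inj_on (\<lambda>\<Sigma>. \<Sigma> \<inter> Y) S"
      using nonempty uniq by (intro inj_onI) blast
    then show eqp: "S \<approx> (\<lambda>\<Sigma>. \<Sigma> \<inter> Y) ` S"
      by (simp add: inj_on_image_eqpoll_self eqpoll_sym)
    have inside: "D a b c d"
      if "\<Sigma> \<in> S" "a \<in> \<Sigma> \<inter> Y" "b \<in> \<Sigma> \<inter> Y" "c \<in> Y - \<Sigma> \<inter> Y" "d \<in> Y - \<Sigma> \<inter> Y" for \<Sigma> a b c d
      using splitting_inside[OF sp that(1)] that sub by blast
    have across: "\<not> D a b c d"
      if "A \<in> S" "B \<in> S" "C \<in> S" "E \<in> S" "distinct [A \<inter> Y, B \<inter> Y, C \<inter> Y, E \<inter> Y]"
        "a \<in> A \<inter> Y" "b \<in> B \<inter> Y" "c \<in> C \<inter> Y" "d \<in> E \<inter> Y" for A B C E a b c d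
      using splitting_across[OF sp that(1-4)] that by auto
    have part: "partition_on Y ((\<lambda>\<Sigma>. \<Sigma> \<inter> Y) ` S)"
    proof (rule partition_onI)
      show "\<Union> ((\<lambda>\<Sigma>. \<Sigma> \<inter> Y) ` S) = Y"
        using splitting_partition[OF sp] sub unfolding partition_on_def by auto
      show "disjnt p q" if "p \<in> (\<lambda>\<Sigma>. \<Sigma> \<inter> Y) ` S" "q \<in> (\<lambda>\<Sigma>. \<Sigma> \<inter> Y) ` S" "p \<noteq> q" for p q
        using that uniq unfolding disjnt_def by blast
      show "{} \<notin> (\<lambda>\<Sigma>. \<Sigma> \<inter> Y) ` S" using nonempty by auto
    qed
    have "infinite ((\<lambda>\<Sigma>. \<Sigma> \<inter> Y) ` S) \<or> 2 < card ((\<lambda>\<Sigma>. \<Sigma> \<inter> Y) ` S)"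
      using big inj by (simp add: card_image finite_image_iff)
    then show "node_splitting Y D ((\<lambda>\<Sigma>. \<Sigma> \<inter> Y) ` S)"
      unfolding node_splitting_def splitting_def
    proof (intro conjI ballI impI)
      show "partition_on Y ((\<lambda>\<Sigma>. \<Sigma> \<inter> Y) ` S)" by (rule part)
    next
      fix \<Sigma> a b c d
      assume "\<Sigma> \<in> (\<lambda>\<Sigma>. \<Sigma> \<inter> Y) ` S" "a \<in> \<Sigma>" "b \<in> \<Sigma>" "c \<in> Y - \<Sigma>" "d \<in> Y - \<Sigma>"
      then show "D a b c d" using inside by auto
    next
      fix A B C E a b c d
      assume "A \<in> (\<lambda>\<Sigma>. \<Sigma> \<inter> Y) ` S" "B \<in> (\<lambda>\<Sigma>. \<Sigma> \<inter> Y) ` S" "C \<in> (\<lambda>\<Sigma>. \<Sigma> \<inter> Y) ` S"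
        "E \<in> (\<lambda>\<Sigma>. \<Sigma> \<inter> Y) ` S" "distinct [A, B, C, E]" "a \<in> A" "b \<in> B" "c \<in> C" "d \<in> E"
      then show "\<not> D a b c d" using across by (elim imageE) metis
    qed linarith+
  qed
  show ?thesis
    unfolding same_node_valency_def
  proof (intro allI impI, elim conjE)
    fix S T assume "node_splitting X D S" "node_splitting X D T"
    then show "S \<approx> T"
      using restrict val unfolding same_node_valency_def by (meson eqpoll_sym eqpoll_trans)
  qed
qed

end

section \<open>Sufficient conditions for homogeneity\<close>

lemma two_le_card_of_coloured:
  assumes "finite A" "A \<inter> P \<noteq> {}" "A - P \<noteq> {}"
  shows "2 \<le> card A"
proof -
  obtain p q where "p \<in> A" "p \<in> P" "q \<in> A" "q \<notin> P" using assms by blast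
  moreover from this have "p \<noteq> q" by blast
  ultimately have "{p, q} \<subseteq> A" "card {p, q} = 2" by auto
  then show ?thesis using card_mono[OF assms(1)] by metis
qed

lemma DP_iso_uncoloured: "DP_iso D P A B f \<Longrightarrow> DP_iso D {} A B f"
  unfolding DP_iso_def by blast

lemma P_homogeneous_Compl:
  assumes "P_homogeneous X D P" "P \<subseteq> X"
  shows "P_homogeneous X D (X - P)"
proof -
  have iso: "DP_iso D (X - P) A B f \<longleftrightarrow> DP_iso D P A B f" if "A \<subseteq> X" "B \<subseteq> X" for A B f
  proof -
    have "(\<forall>x\<in>A. f x \<in> X - P \<longleftrightarrow> x \<in> X - P) \<longleftrightarrow> (\<forall>x\<in>A. f x \<in> P \<longleftrightarrow> x \<in> P)" if "bij_betw f A B"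
      using that \<open>A \<subseteq> X\<close> \<open>B \<subseteq> X\<close> unfolding bij_betw_def by blast
    then show ?thesis unfolding DP_iso_def by blast
  qed
  show ?thesis
    unfolding P_homogeneous_def
  proof (intro allI impI, elim conjE)
    fix A B f
    assume *: "A \<subseteq> X" "finite A" "B \<subseteq> X" "finite B" "A \<inter> (X - P) \<noteq> {}" "A - (X - P) \<noteq> {}"
      "B \<inter> (X - P) \<noteq> {}" "B - (X - P) \<noteq> {}" "DP_iso D (X - P) A B f"
    have "A \<inter> P \<noteq> {}" "A - P \<noteq> {}" "B \<inter> P \<noteq> {}" "B - P \<noteq> {}" "DP_iso D P A B f"
      using * iso by blast+
    then obtain g where "DP_iso D P X X g" "\<forall>a\<in>A. g a = f a"
      using assms(1) * unfolding P_homogeneous_def by meson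
    then show "\<exists>g. DP_iso D (X - P) X X g \<and> (\<forall>a\<in>A. g a = f a)" using iso by blast
  qed
qed

context D_structure
begin

text \<open>By properness each cone is an infinite sector of a node splitting, hence contains both
  colours. This supplies the colour hypothesis of \<open>homogeneous_extension\<close> and carries
  the valency of \<open>P\<close> over to \<open>X\<close>.\<close>

lemma P_homogeneous_if_sectors_bicoloured:
  assumes "D_proper X D" "countable X" "P \<subseteq> X" "D_dense X D" "same_node_valency P D"
    and bi: "\<And>S \<Sigma>. splitting X D S \<Longrightarrow> \<Sigma> \<in> S \<Longrightarrow> infinite \<Sigma> \<Longrightarrow> \<Sigma> \<inter> P \<noteq> {} \<and> \<Sigma> - P \<noteq> {}"
  shows "P_homogeneous X D P"
proof -
  have cone: "{u \<in> X. D u c a b} \<inter> P \<noteq> {} \<and> {u \<in> X. D u c a b} - P \<noteq> {}"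
    if abc: "a \<in> X" "b \<in> X" "c \<in> X" "distinct [a, b, c]" for a b c
  proof (rule bi)
    interpret T: D_triple X D a b c using abc by unfold_locales auto
    show "splitting X D (node_at X D a b c)"
      using T.node_splitting_node_at unfolding node_splitting_def by blast
    have "T.S c v \<longleftrightarrow> D v c a b" if "v \<in> X" for v
      unfolding co_sector_def using that abc D_disjoint D_swap_left by blast
    then have "{v \<in> X. D v c a b} = {v \<in> X. T.S c v}" by blast
    then show "{v \<in> X. D v c a b} \<in> node_at X D a b c" unfolding node_at_def using abc by blast
    show "infinite {v \<in> X. D v c a b}" by (rule infinite_cone[OF assms(1) abc])
  qed
  have val: "same_node_valency X D"
    using same_node_valency_superset[OF assms(3,5)] cone by blast
  have col: "\<exists>y\<in>X. D y c a b \<and> (y \<in> P \<longleftrightarrow> x \<in> P)"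
    if "a \<in> X" "b \<in> X" "c \<in> X" "distinct [a, b, c]" "x \<in> X" for a b c x
    using cone[OF that(1-4)] by blast
  show ?thesis
    unfolding P_homogeneous_def
  proof (intro allI impI, elim conjE)
    fix A B f
    assume *: "A \<subseteq> X" "finite A" "B \<subseteq> X" "finite B" "A \<inter> P \<noteq> {}" "A - P \<noteq> {}" "DP_iso D P A B f"
    show "\<exists>g. DP_iso D P X X g \<and> (\<forall>a\<in>A. g a = f a)"
      using homogeneous_extension[OF assms(2,4) val col *(2) two_le_card_of_coloured *(1,3,7)] * by blast
  qed
qed

text \<open>The point \<open>p\<close> must lie in \<open>A\<close> and be fixed by
  \<open>f\<close>, so every uncoloured automorphism extending \<open>f\<close> respects the
  colours. Infinite cones contain points other than \<open>p\<close>, which transfers the valency to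
  \<open>X\<close>.\<close>

lemma P_homogeneous_if_singleton:
  assumes "D_proper X D" "countable X" "D_dense X D" "same_node_valency (X - {p}) D" "p \<in> X"
  shows "P_homogeneous X D {p}"
proof -
  have val: "same_node_valency X D"
  proof (rule same_node_valency_superset[OF _ assms(4)])
    fix a b c assume abc: "a \<in> X" "b \<in> X" "c \<in> X" "distinct [a, b, c]"
    have "\<not> {u \<in> X. D u c a b} \<subseteq> {p}"
      using infinite_cone[OF assms(1) abc] finite_subset by blast
    then show "\<exists>y\<in>X - {p}. D y c a b" by blast
  qed auto
  have col: "\<exists>y\<in>X. D y c a b \<and> (y \<in> {} \<longleftrightarrow> x \<in> {})"
    if "a \<in> X" "b \<in> X" "c \<in> X" "distinct [a, b, c]" "x \<in> X" for a b c x
    using that D_point_left[of c a b] by auto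
  show ?thesis
    unfolding P_homogeneous_def
  proof (intro allI impI, elim conjE)
    fix A B f
    assume *: "A \<subseteq> X" "finite A" "B \<subseteq> X" "finite B" "A \<inter> {p} \<noteq> {}" "A - {p} \<noteq> {}" "DP_iso D {p} A B f"
    obtain g where g: "DP_iso D {} X X g" "\<forall>a\<in>A. g a = f a"
      using homogeneous_extension[OF assms(2,3) val col *(2) two_le_card_of_coloured[OF *(2,5,6)]
          *(1,3) DP_iso_uncoloured[OF *(7)]] by blast
    have "p \<in> A" "f p = p" using * unfolding DP_iso_def by auto
    then have "g p = p" using g by auto
    moreover have "inj_on g X" using g unfolding DP_iso_def bij_betw_def by blast
    ultimately have "\<forall>x\<in>X. g x \<in> {p} \<longleftrightarrow> x \<in> {p}" using assms(5) by (metis inj_onD singleton_iff)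
    then show "\<exists>g. DP_iso D {p} X X g \<and> (\<forall>a\<in>A. g a = f a)" using g unfolding DP_iso_def by blast
  qed
qed

section \<open>The case of a true edge splitting\<close>

text \<open>An extension inside \<open>P\<close> alone could move the place where the edge to the
  other side is attached. Keeping \<open>q\<close> as a fixed representative of that side prevents
  this.\<close>

lemma edge_side_extension:
  assumes cnt: "countable X" and dense: "D_dense X D" and PX: "P \<subseteq> X"
    and sep: "\<And>a b c d. a \<in> P \<Longrightarrow> b \<in> P \<Longrightarrow> c \<in> X - P \<Longrightarrow> d \<in> X - P \<Longrightarrow> D a b c d"
    and no_node: "\<And>T. node_splitting X D T \<Longrightarrow> \<exists>\<Sigma>\<in>T. \<not> \<Sigma> \<subseteq> P \<and> \<not> \<Sigma> \<subseteq> X - P"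
    and other: "\<And>p. p \<in> P \<Longrightarrow> \<exists>r\<in>P. r \<noteq> p"
    and q: "q \<in> X - P" and val: "same_node_valency P D"
    and A: "finite A" "A \<noteq> {}" "A \<subseteq> P" "B \<subseteq> P"
    and iso: "DP_iso D {} (insert q A) (insert q B) f" and fq: "f q = q"
  shows "\<exists>g. bij_betw g P P \<and> (\<forall>a\<in>A. g a = f a) \<and>
    (\<forall>u\<in>insert q P. \<forall>v\<in>insert q P. \<forall>w\<in>insert q P. \<forall>z\<in>insert q P.
      D (g u) (g v) (g w) (g z) \<longleftrightarrow> D u v w z) \<and> g q = q"
proof -
  define Y where "Y = insert q P"
  have YX: "Y \<subseteq> X" using q PX unfolding Y_def by auto
  interpret Y: D_structure Y D by (rule D_structure_subset[OF YX])
  \<comment> \<open>Some sector at the median of \<open>a, b, r\<close> must contain points of both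
    sides. By \<open>sep\<close> all of \<open>X - P\<close> lies in the sector of \<open>r\<close>,
    so the mixed sector is that one, and it contains the desired \<open>p\<close>.\<close>
  have nearer: "\<exists>p\<in>P. D a b p r" if ab: "a \<in> P" "b \<in> P" "a \<noteq> b" "r \<in> X - P" for a b r
  proof (rule ccontr)
    assume none: "\<not> ?thesis"
    interpret T: D_triple X D a b r using ab PX by unfold_locales auto
    obtain \<Sigma> where \<Sigma>: "\<Sigma> \<in> node_at X D a b r" "\<not> \<Sigma> \<subseteq> P" "\<not> \<Sigma> \<subseteq> X - P"
      using no_node[OF T.node_splitting_node_at] by blast
    obtain s where s: "s \<in> \<Sigma>" "s \<notin> P" using \<Sigma> by blast
    obtain p where p: "p \<in> \<Sigma>" "p \<in> P" using \<Sigma> T.node_at_subset by blast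
    have sX: "s \<in> X" "p \<in> X" using T.node_at_subset \<Sigma> s p by auto
    have rX: "r \<in> X" using ab by blast
    have "D r s a b" using sep[of a b r s] ab s sX T.in_X D_swap_sides by blast
    then have "T.S r s" unfolding co_sector_def by blast
    moreover have "T.S s p" using T.node_at_mem_iff[OF \<Sigma>(1) s(1)] p by blast
    ultimately have "T.S r p" using T.co_sector_trans[of r s p] rX sX by blast
    then have "D r p a b" unfolding co_sector_def using D_disjoint[OF _ rX sX(2)] T.in_X by blast
    then have "D a b p r" using rX sX T.in_X by (meson D_swap_left D_swap_sides)
    then show False using none p by blast
  qed
  have denseY: "D_dense Y D"
  proof -
    have inP: "\<exists>p\<in>Y. D p x y z \<and> D w p y z \<and> D w x p z \<and> D w x y p"
      if m: "w \<in> P" "x \<in> P" "y \<in> P" "z \<in> Y" and D: "D w x y z" for w x y z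
    proof -
      have X: "w \<in> X" "x \<in> X" "y \<in> X" "z \<in> X" using m YX PX by auto
      obtain v where v: "v \<in> X" "D v x y z" "D w v y z" "D w x v z" "D w x y v"
        using dense D X unfolding D_dense_def by meson
      show ?thesis
      proof (cases "v \<in> P")
        case True then show ?thesis using v unfolding Y_def by blast
      next
        case False
        have "z \<in> P"
        proof (rule ccontr)
          assume "z \<notin> P"
          then have "D x y v z" using sep[of x y v z] m False v X by blast
          then show False using v(2) D_excl[of x y v z] D_swap_left X v(1) by blast
        qed
        \<comment> \<open>The midpoint \<open>v\<close> found in \<open>X\<close> is outside
          \<open>P\<close>. A point \<open>p\<close> of \<open>P\<close> that branches off from the
          path between \<open>w\<close> and \<open>y\<close> in the direction of \<open>v\<close>
          has the four required relations too.\<close>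
        have "w \<noteq> y" using D D_disjoint X by blast
        then obtain p where p: "p \<in> P" "D w y p v" using nearer[of w y v] m False v by blast
        have pX: "p \<in> X" using p PX by blast
        have pv: "D p v w y" using p pX v(1) X D_swap_sides by blast
        have wx: "D w x y p"
        proof -
          have "D p x y v \<or> D w x y p" using D_either[of w x y v p] v(5) X v(1) pX by blast
          moreover have "\<not> D p x y v"
          proof
            assume "D p x y v"
            have "D w p y v" using D_trans[of w x y v p] D_swap_left[OF \<open>D p x y v\<close>] v(5) X v(1) pX by blast
            then show False using D_excl[OF \<open>D w p y v\<close>] p X v(1) pX by blast
          qed
          ultimately show ?thesis by blast
        qed
        have wz: "D w x p z"
          using D_trans_right[of w x p y z] wx D D_swap_right X pX by blast
        have yz: "D w p y z"
        proof -
          have "D y z w v" using v(3) D_swap_sides X v(1) by blast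
          then have "D p z w v \<or> D y z w p" using D_either[of y z w v p] X v(1) pX by blast
          moreover have "\<not> D p z w v"
          proof
            assume "D p z w v"
            have "D y p w v" using D_trans[of y z w v p] D_swap_left[OF \<open>D p z w v\<close>] \<open>D y z w v\<close> X v(1) pX by blast
            then show False using p X v(1) pX by (meson D_excl D_swap_left)
          qed
          ultimately show ?thesis using D_swap_sides X pX by blast
        qed
        have px: "D p x y z" using D_trans[of p w y z x] yz D D_swap_left X pX by blast
        show ?thesis using px yz wz wx p unfolding Y_def by blast
      qed
    qed
    have qq: "\<exists>p\<in>Y. D p x q q \<and> D w p q q \<and> D w x p q \<and> D w x q p"
      if m: "w \<in> P" "x \<in> P" for w x
    proof -
      obtain p where p: "p \<in> P" "D w x p q"
      proof (cases "w = x")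
        case True
        obtain p where "p \<in> P" "p \<noteq> w" using other[OF m(1)] by blast
        moreover have "D w w p q" using D_point_left[of w p q] m calculation q PX by blast
        ultimately show ?thesis using that True by blast
      next
        case False
        then show ?thesis using that nearer[OF m False q] by blast
      qed
      have X: "w \<in> X" "x \<in> X" "p \<in> X" "q \<in> X" "w \<noteq> q" "x \<noteq> q" "p \<noteq> q" using m p q PX by auto
      have "D p x q q" "D w p q q" using D_point X by blast+
      then show ?thesis using p D_swap_right[OF p(2)] X unfolding Y_def by blast
    qed
    have mid: "\<exists>v\<in>Y. D v x y z \<and> D w v y z \<and> D w x v z \<and> D w x y v"
      if m: "w \<in> Y" "x \<in> Y" "y \<in> Y" "z \<in> Y" and D: "D w x y z" and wx: "w \<noteq> q" "x \<noteq> q" for w x y z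
    proof -
      have wxP: "w \<in> P" "x \<in> P" using m wx unfolding Y_def by auto
      consider "y \<in> P" | "z \<in> P" "y = q" | "y = q" "z = q" using m unfolding Y_def by blast
      then show ?thesis
      proof cases
        case 1 then show ?thesis using inP[of w x y z] wxP m D by blast
      next
        case 2
        have "D w x z y" using D m Y.D_swap_right by blast
        then obtain v where v: "v \<in> Y" "D v x z y" "D w v z y" "D w x v y" "D w x z v"
          using inP[of w x z y] wxP 2 m by blast
        then have "D v x y z" "D w v y z" "D w x y v" "D w x v z"
          using m by (meson Y.D_swap_right)+
        then show ?thesis using v(1) by blast
      next
        case 3 then show ?thesis using qq[of w x] wxP by blast
      qed
    qed
    have "\<exists>v\<in>Y. D v x y z \<and> D w v y z \<and> D w x v z \<and> D w x y v"
      if m: "w \<in> Y" "x \<in> Y" "y \<in> Y" "z \<in> Y" and D: "D w x y z" for w x y z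
    proof (cases "w \<noteq> q \<and> x \<noteq> q")
      case True
      then show ?thesis using mid[OF m D] by blast
    next
      case False
      then have "y \<noteq> q" "z \<noteq> q" using Y.D_disjoint[OF D m] by auto
      then obtain v where v: "v \<in> Y" "D v z w x" "D y v w x" "D y z v x" "D y z w v"
        using mid[of y z w x] m D Y.D_swap_sides by blast
      then have "D v x y z" "D w v y z" "D w x v z" "D w x y v"
        using m by (meson Y.D_swap_sides)+
      then show ?thesis using v(1) by blast
    qed
    moreover have "infinite Y \<or> 2 \<le> card Y"
      using two_le_card_of_coloured[of Y P] A q unfolding Y_def by auto
    ultimately show ?thesis unfolding D_dense_def by blast
  qed
  have valY: "same_node_valency Y D"
  proof (rule Y.same_node_valency_superset[OF _ val])
    fix a b c assume abc: "a \<in> Y" "b \<in> Y" "c \<in> Y" "distinct [a, b, c]"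
    show "\<exists>y\<in>P. D y c a b"
    proof (cases "c = q")
      case True
      then have "a \<in> P" "b \<in> P" "a \<noteq> b" using abc unfolding Y_def by auto
      then obtain p where "p \<in> P" "D a b p q" using nearer[of a b q] q by blast
      moreover have "p \<in> Y" using calculation unfolding Y_def by blast
      ultimately show ?thesis using Y.D_swap_sides[of a b p q] abc True by blast
    next
      case False
      then have "c \<in> P" using abc unfolding Y_def by blast
      then show ?thesis using Y.D_point_left[of c a b] abc by auto
    qed
  qed (auto simp: Y_def)
  have cone: "\<exists>y\<in>Y. D y c a b \<and> (y \<in> {} \<longleftrightarrow> x \<in> {})"
    if "a \<in> Y" "b \<in> Y" "c \<in> Y" "distinct [a, b, c]" "x \<in> Y" for a b c x
    using that Y.D_point_left[of c a b] by auto
  have cntY: "countable Y" using cnt YX countable_subset by blast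
  have sub: "finite (insert q A)" "insert q A \<subseteq> Y" "insert q B \<subseteq> Y" using A unfolding Y_def by auto
  have two: "2 \<le> card (insert q A)" using two_le_card_of_coloured[of "insert q A" P] A q by auto
  obtain g where g: "DP_iso D {} Y Y g" "\<forall>a\<in>insert q A. g a = f a"
    using Y.homogeneous_extension[OF cntY denseY valY cone sub(1) two sub(2,3) iso] by blast
  have gq: "g q = q" using g fq by auto
  have bij: "bij_betw g Y Y" using g unfolding DP_iso_def by blast
  have P: "P = Y - {q}" using q unfolding Y_def by auto
  have "bij_betw g P P"
    unfolding P using bij_betw_DiffI[OF bij, of "{q}" "{q}"] gq unfolding Y_def by auto
  then show ?thesis using g gq unfolding DP_iso_def Y_def by blast
qed

text \<open>The maps of the two sides fit together because \<open>D\<close> is decided by the sides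
  alone when two points lie on each, and when three lie on one side the fourth point counts only
  through its side.\<close>

lemma P_homogeneous_if_true_edge_splitting:
  assumes cnt: "countable X" and dense: "D_dense X D" and PX: "P \<subseteq> X"
    and val: "same_node_valency P D" "same_node_valency (X - P) D"
    and edge: "true_edge_splitting X D {P, X - P}"
  shows "P_homogeneous X D P"
proof -
  have sp: "splitting X D {P, X - P}" and card: "card {P, X - P} = 2"
    and ref: "\<And>T. node_splitting X D T \<Longrightarrow> \<not> refines X T {P, X - P}"
    and sing: "\<not> is_singleton P" "\<not> is_singleton (X - P)"
    using edge unfolding true_edge_splitting_def edge_splitting_def by blast+
  have part: "partition_on X {P, X - P}" by (rule splitting_partition[OF sp])
  then have ne: "P \<noteq> {}" "X - P \<noteq> {}" unfolding partition_on_def by auto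
  have sep: "D a b c d" if "a \<in> P" "b \<in> P" "c \<in> X - P" "d \<in> X - P" for a b c d
    using splitting_inside[OF sp _ that] by blast
  have sep': "D a b c d" if "a \<in> X - P" "b \<in> X - P" "c \<in> P" "d \<in> P" for a b c d
    using sep[OF that(3,4,1,2)] that PX D_swap_sides by blast
  have no_node: "\<exists>\<Sigma>\<in>T. \<not> \<Sigma> \<subseteq> P \<and> \<not> \<Sigma> \<subseteq> X - P" if "node_splitting X D T" for T
  proof -
    have "partition_on X T" using that splitting_partition unfolding node_splitting_def by blast
    then show ?thesis using ref[OF that] part unfolding refines_def by auto
  qed
  have other: "\<exists>r\<in>F. r \<noteq> p" if "\<not> is_singleton F" "p \<in> F" for F and p :: 'a
    using that unfolding is_singleton_def by blast
  \<comment> \<open>From \<open>F\<close> all points of \<open>G\<close> look alike: exchanging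
    \<open>r\<close> for \<open>s\<close> could fail only if \<open>D s v w r\<close>, which crosses
    \<open>D v w s r\<close>.\<close>
  have swap_one: "D u v w r \<longleftrightarrow> D u v w s"
    if "u \<in> F" "v \<in> F" "w \<in> F" "r \<in> G" "s \<in> G" "F \<subseteq> X" "G \<subseteq> X"
      "\<And>a b c d. a \<in> F \<Longrightarrow> b \<in> F \<Longrightarrow> c \<in> G \<Longrightarrow> d \<in> G \<Longrightarrow> D a b c d" for u v w r s F G
  proof -
    have *: "D u v w s" if "D u v w r" "r \<in> G" "s \<in> G" for r s
    proof -
      have X: "u \<in> X" "v \<in> X" "w \<in> X" "r \<in> X" "s \<in> X"
        using that \<open>u \<in> F\<close> \<open>v \<in> F\<close> \<open>w \<in> F\<close> \<open>F \<subseteq> X\<close> \<open>G \<subseteq> X\<close> by auto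
      have "D v w s r"
        by (rule \<open>\<And>a b c d. a \<in> F \<Longrightarrow> b \<in> F \<Longrightarrow> c \<in> G \<Longrightarrow> d \<in> G \<Longrightarrow> D a b c d\<close>) fact+
      then have "\<not> D s v w r" using D_excl[of v w s r] D_swap_left X by blast
      then show ?thesis using D_either[of u v w r s] that(1) X by blast
    qed
    show ?thesis using *[of r s] *[of s r] that(4,5) by blast
  qed
  have QX: "X - P \<subseteq> X" by blast
  have side: "\<exists>g. bij_betw g F F \<and> (\<forall>a\<in>A \<inter> F. g a = f a) \<and>
      (\<forall>u\<in>F. \<forall>v\<in>F. \<forall>w\<in>F. \<forall>z\<in>F. D (g u) (g v) (g w) (g z) \<longleftrightarrow> D u v w z) \<and>
      (\<forall>u\<in>F. \<forall>v\<in>F. \<forall>w\<in>F. \<forall>r\<in>X - F. \<forall>s\<in>X - F. D (g u) (g v) (g w) s \<longleftrightarrow> D u v w r)"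
    if F: "F = P \<or> F = X - P" and A: "A \<subseteq> X" "finite A" "B \<subseteq> X" "A \<inter> F \<noteq> {}" "A - F \<noteq> {}"
      and iso: "DP_iso D F A B f" for F A B f
  proof -
    have FX: "F \<subseteq> X" "X - F \<subseteq> X" using F PX by auto
    have sepF: "D a b c d" if "a \<in> F" "b \<in> F" "c \<in> X - F" "d \<in> X - F" for a b c d
      using F that sep[of a b c d] sep'[of a b c d] PX by blast
    have sw: "D u v w r \<longleftrightarrow> D u v w s" if "u \<in> F" "v \<in> F" "w \<in> F" "r \<in> X - F" "s \<in> X - F" for u v w r s
      using swap_one[OF that FX sepF] .
    obtain q where q: "q \<in> A" "q \<in> X - F" using A by blast
    have fq: "f q \<in> X - F" using iso q A unfolding DP_iso_def bij_betw_def by blast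
    have fF: "f u \<in> F" "f u \<in> B" if "u \<in> A \<inter> F" for u
      using iso that unfolding DP_iso_def bij_betw_def by blast+
    have isoF: "DP_iso D {} (A \<inter> F) (B \<inter> F) f"
    proof -
      have "bij_betw f A B" and FF: "\<And>x. x \<in> A \<Longrightarrow> f x \<in> F \<longleftrightarrow> x \<in> F" using iso unfolding DP_iso_def by auto
      then have "f ` (A \<inter> F) = B \<inter> F" "inj_on f (A \<inter> F)" unfolding bij_betw_def inj_on_def by auto
      then have "bij_betw f (A \<inter> F) (B \<inter> F)" unfolding bij_betw_def by blast
      then show ?thesis using iso unfolding DP_iso_def by simp
    qed
    \<comment> \<open>The map \<open>f\<close> need not fix \<open>q\<close>, but \<open>f q\<close>
      is also in \<open>X - F\<close> and by \<open>sw\<close> indistinguishable from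
      \<open>q\<close> there, so \<open>q\<close> may be sent to itself.\<close>
    have isoq: "DP_iso D {} (insert q (A \<inter> F)) (insert q (B \<inter> F)) (f(q := q))"
    proof (rule DP_iso_insert[OF isoF])
      fix u v w assume uvw: "u \<in> A \<inter> F" "v \<in> A \<inter> F" "w \<in> A \<inter> F"
      have X: "u \<in> X" "v \<in> X" "w \<in> X" "f u \<in> X" "f v \<in> X" "f w \<in> X" "q \<in> X" "f q \<in> X"
        using uvw A(1) fF FX q fq by auto
      have "D u v w q \<longleftrightarrow> D (f u) (f v) (f w) (f q)" using iso uvw q unfolding DP_iso_def by blast
      also have "\<dots> \<longleftrightarrow> D (f u) (f v) (f w) q" using sw[OF fF(1) fF(1) fF(1) fq q(2)] uvw by blast
      finally show "D (f u) (f v) q (f w) \<longleftrightarrow> D u v q w" using D_swap_right X by blast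
    qed (use A q FX in auto)
    obtain g where g: "bij_betw g F F" "\<forall>a\<in>A \<inter> F. g a = (f(q := q)) a" "g q = q"
      "\<forall>u\<in>insert q F. \<forall>v\<in>insert q F. \<forall>w\<in>insert q F. \<forall>z\<in>insert q F.
        D (g u) (g v) (g w) (g z) \<longleftrightarrow> D u v w z"
    proof -
      have no_nodeF: "\<exists>\<Sigma>\<in>T. \<not> \<Sigma> \<subseteq> F \<and> \<not> \<Sigma> \<subseteq> X - F" if "node_splitting X D T" for T
        using no_node[OF that] F PX by (metis double_diff subset_refl)
      have sub: "finite (A \<inter> F)" "A \<inter> F \<subseteq> F" "B \<inter> F \<subseteq> F" using A by auto
      have vF: "same_node_valency F D" and oF: "\<And>p. p \<in> F \<Longrightarrow> \<exists>r\<in>F. r \<noteq> p"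
        using F val sing other by auto
      show ?thesis
        using edge_side_extension[OF cnt dense FX(1) sepF no_nodeF oF q(2) vF sub(1) A(4) sub(2,3) isoq]
          that by auto
    qed
    have three: "D (g u) (g v) (g w) s \<longleftrightarrow> D u v w r"
      if "u \<in> F" "v \<in> F" "w \<in> F" "r \<in> X - F" "s \<in> X - F" for u v w r s
    proof -
      have gF: "g u \<in> F" "g v \<in> F" "g w \<in> F" using g(1) that unfolding bij_betw_def by auto
      have "D u v w r \<longleftrightarrow> D u v w q" by (rule sw[OF that(1-4) q(2)])
      also have "\<dots> \<longleftrightarrow> D (g u) (g v) (g w) (g q)" using g(4) that by blast
      also have "\<dots> \<longleftrightarrow> D (g u) (g v) (g w) s" unfolding g(3) by (rule sw[OF gF q(2) that(5)])
      finally show ?thesis by blast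
    qed
    have gf: "\<forall>a\<in>A \<inter> F. g a = f a" using g(2) q by auto
    have four: "D (g u) (g v) (g w) (g z) \<longleftrightarrow> D u v w z"
      if "u \<in> F" "v \<in> F" "w \<in> F" "z \<in> F" for u v w z
      using g(4) that by blast
    show ?thesis by (intro exI[of _ g] conjI ballI g(1) gf four three)
  qed
  show ?thesis
    unfolding P_homogeneous_def
  proof (intro allI impI, elim conjE)
    fix A B f
    assume *: "A \<subseteq> X" "finite A" "B \<subseteq> X" "finite B" "A \<inter> P \<noteq> {}" "A - P \<noteq> {}" "DP_iso D P A B f"
    have isoQ: "DP_iso D (X - P) A B f"
    proof -
      have "f ` A \<subseteq> X" using *(3,7) unfolding DP_iso_def bij_betw_def by blast
      then show ?thesis using *(1,7) unfolding DP_iso_def by auto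
    qed
    obtain g where g: "bij_betw g P P" "\<forall>a\<in>A \<inter> P. g a = f a"
      "\<forall>u\<in>P. \<forall>v\<in>P. \<forall>w\<in>P. \<forall>z\<in>P. D (g u) (g v) (g w) (g z) \<longleftrightarrow> D u v w z"
      "\<forall>u\<in>P. \<forall>v\<in>P. \<forall>w\<in>P. \<forall>r\<in>X - P. \<forall>s\<in>X - P. D (g u) (g v) (g w) s \<longleftrightarrow> D u v w r"
      using side[OF disjI1[OF refl] *(1,2,3,5,6,7)] by (elim exE conjE)
    have PP: "X - (X - P) = P" and AQ: "A \<inter> (X - P) \<noteq> {}" "A - (X - P) \<noteq> {}" using PX *(1,5,6) by auto
    obtain h where h: "bij_betw h (X - P) (X - P)" "\<forall>a\<in>A \<inter> (X - P). h a = f a"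
      "\<forall>u\<in>X - P. \<forall>v\<in>X - P. \<forall>w\<in>X - P. \<forall>z\<in>X - P. D (h u) (h v) (h w) (h z) \<longleftrightarrow> D u v w z"
      "\<forall>u\<in>X - P. \<forall>v\<in>X - P. \<forall>w\<in>X - P. \<forall>r\<in>P. \<forall>s\<in>P. D (h u) (h v) (h w) s \<longleftrightarrow> D u v w r"
      using side[OF disjI2[OF refl] *(1,2,3) AQ isoQ] unfolding PP by (elim exE conjE)
    define k where "k x = (if x \<in> P then g x else h x)" for x
    have kP: "k x \<in> P" "k x = g x" if "x \<in> P" for x
      using g(1) that unfolding k_def bij_betw_def by auto
    have kQ: "k x \<in> X - P" "k x = h x" if "x \<in> X - P" for x
      using h(1) that unfolding k_def bij_betw_def by auto
    have kX: "k x \<in> X" if "x \<in> X" for x using kP(1)[of x] kQ(1)[of x] that PX by blast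
    have "bij_betw k P P" "bij_betw k (X - P) (X - P)"
      using g(1) h(1) bij_betw_cong[of P k g P] bij_betw_cong[of "X - P" k h "X - P"] kP(2) kQ(2) by auto
    then have "bij_betw k (P \<union> (X - P)) (P \<union> (X - P))" by (rule bij_betw_combine) auto
    then have bij: "bij_betw k X X" using PX by (simp add: Un_absorb1)
    have four: "D (k u) (k v) (k w) (k z) \<longleftrightarrow> D u v w z"
      if "{u, v, w, z} \<subseteq> P \<or> {u, v, w, z} \<subseteq> X - P" for u v w z
      using that g(3) h(3) kP(2) kQ(2) by auto
    have three: "D (k u) (k v) (k w) (k z) \<longleftrightarrow> D u v w z"
      if "{u, v, w} \<subseteq> P \<and> z \<in> X - P \<or> {u, v, w} \<subseteq> X - P \<and> z \<in> P" for u v w z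
      using that g(4) h(4) kP kQ by auto
    have two: "D u v w z" if "{u, v} \<subseteq> P \<and> {w, z} \<subseteq> X - P \<or> {u, v} \<subseteq> X - P \<and> {w, z} \<subseteq> P" for u v w z
      using that sep[of u v w z] sep'[of u v w z] by auto
    have cross: "\<not> D u v w z" "\<not> D u v z w"
      if "{u, w} \<subseteq> P \<and> {v, z} \<subseteq> X - P \<or> {u, w} \<subseteq> X - P \<and> {v, z} \<subseteq> P" for u v w z
    proof -
      have X: "u \<in> X" "v \<in> X" "w \<in> X" "z \<in> X" using that PX by auto
      have "D u w v z" using two that by blast
      then show "\<not> D u v w z" "\<not> D u v z w" using D_excl D_swap_right X by blast+
    qed
    have "D (k u) (k v) (k w) (k z) \<longleftrightarrow> D u v w z"
      if m: "u \<in> X" "v \<in> X" "w \<in> X" "z \<in> X" for u v w z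
    proof -
      have rot: "D v u w z \<longleftrightarrow> D u v w z" "D w z u v \<longleftrightarrow> D u v w z" "D w z v u \<longleftrightarrow> D u v w z"
        "D (k v) (k u) (k w) (k z) \<longleftrightarrow> D (k u) (k v) (k w) (k z)"
        "D (k w) (k z) (k u) (k v) \<longleftrightarrow> D (k u) (k v) (k w) (k z)"
        "D (k w) (k z) (k v) (k u) \<longleftrightarrow> D (k u) (k v) (k w) (k z)"
        "D u v z w \<longleftrightarrow> D u v w z"
        "D (k u) (k v) (k z) (k w) \<longleftrightarrow> D (k u) (k v) (k w) (k z)"
        using m kX by (meson D_swap_left D_swap_right D_swap_sides)+
      consider
          "{u, v, w, z} \<subseteq> P \<or> {u, v, w, z} \<subseteq> X - P"
        | "{u, v, w} \<subseteq> P \<and> z \<in> X - P \<or> {u, v, w} \<subseteq> X - P \<and> z \<in> P"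
        | "{u, v, z} \<subseteq> P \<and> w \<in> X - P \<or> {u, v, z} \<subseteq> X - P \<and> w \<in> P"
        | "{w, z, u} \<subseteq> P \<and> v \<in> X - P \<or> {w, z, u} \<subseteq> X - P \<and> v \<in> P"
        | "{w, z, v} \<subseteq> P \<and> u \<in> X - P \<or> {w, z, v} \<subseteq> X - P \<and> u \<in> P"
        | "{u, v} \<subseteq> P \<and> {w, z} \<subseteq> X - P \<or> {u, v} \<subseteq> X - P \<and> {w, z} \<subseteq> P"
        | "{u, w} \<subseteq> P \<and> {v, z} \<subseteq> X - P \<or> {u, w} \<subseteq> X - P \<and> {v, z} \<subseteq> P"
        | "{u, z} \<subseteq> P \<and> {v, w} \<subseteq> X - P \<or> {u, z} \<subseteq> X - P \<and> {v, w} \<subseteq> P"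
        using m by (cases "u \<in> P"; cases "v \<in> P"; cases "w \<in> P"; cases "z \<in> P"; simp)
      then show ?thesis
      proof cases
        case 1 then show ?thesis by (rule four)
      next
        case 2 then show ?thesis by (rule three)
      next
        case 3 then show ?thesis using three[OF 3] rot by blast
      next
        case 4 then show ?thesis using three[OF 4] rot by blast
      next
        case 5 then show ?thesis using three[OF 5] rot by blast
      next
        case 6
        then have "{k u, k v} \<subseteq> P \<and> {k w, k z} \<subseteq> X - P \<or> {k u, k v} \<subseteq> X - P \<and> {k w, k z} \<subseteq> P"
          using kP(1) kQ(1) by auto
        then show ?thesis using two[OF 6] two by blast
      next
        case 7
        then have "{k u, k w} \<subseteq> P \<and> {k v, k z} \<subseteq> X - P \<or> {k u, k w} \<subseteq> X - P \<and> {k v, k z} \<subseteq> P"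
          using kP(1) kQ(1) by auto
        then show ?thesis using cross(1)[OF 7] cross(1) by blast
      next
        case 8
        then have "{k u, k z} \<subseteq> P \<and> {k v, k w} \<subseteq> X - P \<or> {k u, k z} \<subseteq> X - P \<and> {k v, k w} \<subseteq> P"
          using kP(1) kQ(1) by auto
        then show ?thesis using cross(2)[OF 8] cross(2) by blast
      qed
    qed
    moreover have "k x \<in> P \<longleftrightarrow> x \<in> P" if "x \<in> X" for x using kP(1)[of x] kQ(1)[of x] that by blast
    ultimately have "DP_iso D P X X k" using bij unfolding DP_iso_def by blast
    moreover have "k a = f a" if "a \<in> A" for a
      using g(2) h(2) that *(1) unfolding k_def by auto
    ultimately show "\<exists>g. DP_iso D P X X g \<and> (\<forall>a\<in>A. g a = f a)" by blast
  qed
qed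

section \<open>Consequences of homogeneity\<close>

text \<open>Read \<open>D a b c r\<close> as: on the way from \<open>a\<close> to \<open>r\<close>,
  the branch to \<open>b\<close> leaves before the branch to \<open>c\<close>. This order is
  transitive and looks the same from \<open>b\<close>.\<close>

lemma D_nest:
  assumes "D a b c r" "D a c d r" "a \<in> X" "b \<in> X" "c \<in> X" "d \<in> X" "r \<in> X"
  shows "D a b d r" "D b c d r"
proof -
  have "D b c r d \<or> D a c r b"
    using D_either[of a c r d b] D_swap_right[OF assms(2)] assms by blast
  moreover have "\<not> D a c r b" using assms by (meson D_excl D_swap_right)
  ultimately show "D b c d r" using D_swap_right assms by blast
  then show "D a b d r" using D_trans[of a c d r b] D_swap_left[of b c d r] assms by blast
qed

text \<open>The witness \<open>s\<close> is the one of \<open>w, x\<close> that leaves the path from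
  \<open>p\<close> to \<open>q\<close> later. Everything leaving after it is separated, together
  with \<open>q\<close>, from both.\<close>

lemma exists_branch_at:
  assumes "w \<noteq> x" "p \<noteq> q" "w \<in> X" "x \<in> X" "p \<in> X" "q \<in> X"
  obtains s where "s = w \<or> s = x" "s \<noteq> p" "\<And>v. v \<in> X \<Longrightarrow> D p s v q \<Longrightarrow> D w x v q"
proof (cases "D p w x q")
  case True
  show ?thesis
  proof (rule that[of x])
    show "x \<noteq> p" using D_disjoint[OF True] assms by blast
    fix v assume v: "v \<in> X" "D p x v q"
    then have "D w x q v \<or> D p x q w" using D_either[of p x q v w] D_swap_right assms by blast
    moreover have "\<not> D p x q w" using True assms by (meson D_excl D_swap_right)
    ultimately show "D w x v q" using D_swap_right assms v by blast
  qed simp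
next
  case False
  show ?thesis
  proof (rule that[of w])
    show "w \<noteq> p" using False D_point_left[of p x q] assms by blast
    fix v assume v: "v \<in> X" "D p w v q"
    then have "D x w q v \<or> D p w q x" using D_either[of p w q v x] D_swap_right assms by blast
    then show "D w x v q" using False assms v by (meson D_swap_left D_swap_right)
  qed simp
qed

lemma homogeneous_move:
  assumes hom: "P_homogeneous X D P"
    and A: "A \<subseteq> X" "finite A" "A \<inter> P \<noteq> {}" "A - P \<noteq> {}"
    and xy: "x \<in> X - A" "y \<in> X - A" "y \<in> P \<longleftrightarrow> x \<in> P"
    and D: "\<And>u v w. u \<in> A \<Longrightarrow> v \<in> A \<Longrightarrow> w \<in> A \<Longrightarrow> D u v y w \<longleftrightarrow> D u v x w"
  obtains g where "DP_iso D P X X g" "\<And>a. a \<in> A \<Longrightarrow> g a = a" "g x = y"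
proof -
  have "DP_iso D P A A (\<lambda>a. a)" unfolding DP_iso_def by (simp add: bij_betw_def)
  then have iso: "DP_iso D P (insert x A) (insert y A) ((\<lambda>a. a)(x := y))"
    using DP_iso_insert[OF _ A(1,1) xy, of "\<lambda>a. a"] D by blast
  have "insert x A \<subseteq> X \<and> finite (insert x A) \<and> insert y A \<subseteq> X \<and> finite (insert y A) \<and>
      insert x A \<inter> P \<noteq> {} \<and> insert x A - P \<noteq> {} \<and> insert y A \<inter> P \<noteq> {} \<and> insert y A - P \<noteq> {} \<and>
      DP_iso D P (insert x A) (insert y A) ((\<lambda>a. a)(x := y))"
    using A xy iso by auto
  then obtain g where g: "DP_iso D P X X g" "\<forall>a\<in>insert x A. g a = ((\<lambda>a. a)(x := y)) a"
    using hom unfolding P_homogeneous_def by meson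
  have "g a = a" if "a \<in> A" for a using g(2) that xy by auto
  moreover have "g x = y" using g(2) by auto
  ultimately show ?thesis using that g(1) by blast
qed

text \<open>A quadruple made of one further point and three entries from \<open>{p, q}\<close> has a
  repetition. So over the pair \<open>p, q\<close> a further point has no type except its
  colour.\<close>

lemma homogeneous_move_over_pair:
  assumes hom: "P_homogeneous X D P" and pq: "p \<in> X" "q \<in> X" "(p \<in> P) \<noteq> (q \<in> P)"
    and xy: "x \<in> X" "y \<in> X" "x \<notin> {p, q}" "y \<notin> {p, q}" "y \<in> P \<longleftrightarrow> x \<in> P"
  obtains g where "DP_iso D P X X g" "g p = p" "g q = q" "g x = y"
proof -
  have same: "D u v y w \<longleftrightarrow> D u v x w" if m: "u \<in> {p, q}" "v \<in> {p, q}" "w \<in> {p, q}" for u v w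
  proof -
    have mX: "u \<in> X" "v \<in> X" "w \<in> X" using m pq by auto
    have d: "\<not> distinct [u, v, x, w]" "\<not> distinct [u, v, y, w]" using m by auto
    show ?thesis
      using D_degenerate_iff[OF d(1) mX(1,2) xy(1) mX(3)] D_degenerate_iff[OF d(2) mX(1,2) xy(2) mX(3)]
        m xy(3,4) by auto
  qed
  have A: "{p, q} \<subseteq> X" "finite {p, q}" "{p, q} \<inter> P \<noteq> {}" "{p, q} - P \<noteq> {}"
    "x \<in> X - {p, q}" "y \<in> X - {p, q}"
    using pq xy by auto
  obtain g where "DP_iso D P X X g" "\<And>a. a \<in> {p, q} \<Longrightarrow> g a = a" "g x = y"
    using homogeneous_move[OF hom A xy(5) same] by blast
  then show ?thesis using that by auto
qed

lemma automorphism_facts: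
  assumes "DP_iso D P X X g"
  shows "\<And>u. u \<in> X \<Longrightarrow> g u \<in> X" "\<And>u. u \<in> X \<Longrightarrow> g u \<in> P \<longleftrightarrow> u \<in> P"
    "\<And>u v. u \<in> X \<Longrightarrow> v \<in> X \<Longrightarrow> g u = g v \<longleftrightarrow> u = v"
    "\<And>y. y \<in> X \<Longrightarrow> \<exists>u\<in>X. g u = y"
    "\<And>u v w z. u \<in> X \<Longrightarrow> v \<in> X \<Longrightarrow> w \<in> X \<Longrightarrow> z \<in> X \<Longrightarrow> D (g u) (g v) (g w) (g z) \<longleftrightarrow> D u v w z"
proof -
  have bij: "inj_on g X" "g ` X = X" using assms unfolding DP_iso_def bij_betw_def by auto
  show "g u \<in> X" if "u \<in> X" for u using bij that by blast
  show "g u \<in> P \<longleftrightarrow> u \<in> P" if "u \<in> X" for u using assms that unfolding DP_iso_def by blast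
  show "g u = g v \<longleftrightarrow> u = v" if "u \<in> X" "v \<in> X" for u v using bij(1) that by (metis inj_onD)
  show "\<exists>u\<in>X. g u = y" if "y \<in> X" for y using bij(2) that by (metis imageE)
  show "D (g u) (g v) (g w) (g z) \<longleftrightarrow> D u v w z" if "u \<in> X" "v \<in> X" "w \<in> X" "z \<in> X" for u v w z
    using assms that unfolding DP_iso_def by blast
qed

section \<open>Density from homogeneity\<close>

definition has_middle where
  "has_middle w x y z \<longleftrightarrow> (\<exists>v\<in>X. D v x y z \<and> D w v y z \<and> D w x v z \<and> D w x y v)"

lemma has_middle_swap:
  assumes "has_middle y z w x" "w \<in> X" "x \<in> X" "y \<in> X" "z \<in> X"
  shows "has_middle w x y z"
proof -
  obtain v where "v \<in> X" "D v z w x" "D y v w x" "D y z v x" "D y z w v"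
    using assms(1) unfolding has_middle_def by blast
  then have "v \<in> X" "D v x y z" "D w v y z" "D w x v z" "D w x y v"
    using assms(2-) by (meson D_swap_sides)+
  then show ?thesis unfolding has_middle_def by blast
qed

text \<open>
  The automorphism fixing \<open>p\<close>, \<open>q\<close>, \<open>s\<close> and pushing \<open>t\<close> out to \<open>t'\<close> pulls \<open>t\<close> back
  into the middle.
\<close>

lemma has_middle_if_repeated_colour:
  assumes hom: "P_homogeneous X D P" and pq: "(p \<in> P) \<noteq> (q \<in> P)"
    and X: "p \<in> X" "q \<in> X" "s \<in> X" "t \<in> X" "t' \<in> X"
    and D: "D p s t q" "D p t t' q" and ne: "s \<noteq> p" "t \<noteq> q" "t' \<noteq> q" and col: "t' \<in> P \<longleftrightarrow> t \<in> P"
  shows "has_middle p s t q"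
proof -
  have st': "D p s t' q" "D s t t' q" using D_nest[OF D X(1,3,4,5,2)] by blast+
  have pne: "p \<noteq> q" using pq by blast
  have dis: "t \<notin> {p, q, s}" "t' \<notin> {p, q, s}" "s \<noteq> q"
    using D_disjoint[OF D(1)] D_disjoint[OF st'(1)] X ne by auto
  have same: "D u v t' w \<longleftrightarrow> D u v t w" if m: "u \<in> {p, q, s}" "v \<in> {p, q, s}" "w \<in> {p, q, s}" for u v w
  proof (cases "distinct [u, v, w]")
    case False
    have mX: "u \<in> X" "v \<in> X" "w \<in> X" using m X by auto
    have d: "\<not> distinct [u, v, t, w]" "\<not> distinct [u, v, t', w]" using False by auto
    show ?thesis
      using D_degenerate_iff[OF d(1) mX(1,2) X(4) mX(3)] D_degenerate_iff[OF d(2) mX(1,2) X(5) mX(3)]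
        m dis by auto
  next
    case True
    \<comment> \<open>For a point \<open>r\<close> other than \<open>p, q, s\<close> the relation
      \<open>D p s r q\<close> settles all nondegenerate relations with these three, so
      \<open>t\<close> and \<open>t'\<close> have the same type over them.\<close>
    have *: "D p s r q \<Longrightarrow> r \<in> X \<Longrightarrow>
        D s p r q \<and> \<not> D p q r s \<and> \<not> D q p r s \<and> \<not> D s q r p \<and> \<not> D q s r p" for r
      using X by (meson D_excl D_swap_left D_swap_right)
    show ?thesis using *[OF D(1) X(4)] *[OF st'(1) X(5)] D(1) st'(1) m True by auto
  qed
  have A: "{p, q, s} \<subseteq> X" "finite {p, q, s}" "{p, q, s} \<inter> P \<noteq> {}" "{p, q, s} - P \<noteq> {}"
    using X pq by auto
  have "t \<in> X - {p, q, s}" "t' \<in> X - {p, q, s}" using X dis by auto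
  then obtain g where g: "DP_iso D P X X g" "\<And>a. a \<in> {p, q, s} \<Longrightarrow> g a = a" "g t = t'"
    using homogeneous_move[OF hom A _ _ col same] by blast
  note gf = automorphism_facts[OF g(1)]
  have gs: "g p = p" "g q = q" "g s = s" using g(2) by auto
  obtain u where u: "u \<in> X" "g u = t" using gf(4) X by blast
  have "D p s t' t" using D_trans_right[of p s t' q t] st'(1) D(1) D_swap_right X by blast
  then have "D u s t q" "D p u t q" "D p s u q" "D p s t u"
    using gf(5)[of u s t q] gf(5)[of p u t q] gf(5)[of p s u q] gf(5)[of p s t u]
      st' D u X gs g(3) D_swap_left[OF st'(2)] by auto
  then show ?thesis unfolding has_middle_def using u(1) by blast
qed

text \<open>In the presence of a gap, \<open>has_middle_if_repeated_colour\<close> forces every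
  point between \<open>t\<close> and \<open>q\<close> to have the colour opposite to
  \<open>t\<close>, and symmetrically \<open>s'\<close> to have the colour opposite to
  \<open>s\<close>. Hence one of \<open>s, s'\<close> has the colour of \<open>t'\<close>, and it
  can be moved.\<close>

lemma has_middle_if_bicoloured_ends:
  assumes hom: "P_homogeneous X D P" and proper: "D_proper X D" and pq: "(p \<in> P) \<noteq> (q \<in> P)"
    and X: "p \<in> X" "q \<in> X" "s \<in> X" "t \<in> X" and D: "D p s t q" and ne: "s \<noteq> p" "t \<noteq> q"
  shows "has_middle p s t q"
proof (rule ccontr)
  assume none: "\<not> ?thesis"
  have closer: "\<exists>z\<in>X. z \<noteq> y \<and> D w x y z" if "w \<in> X" "x \<in> X" "y \<in> X" "distinct [w, x, y]" for w x y
    using proper that unfolding D_proper_def by auto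
  have pne: "p \<noteq> q" using pq by blast
  have dis: "p \<noteq> t" "s \<noteq> q" "s \<noteq> t" using D_disjoint[OF D] X by auto
  obtain t' where t': "t' \<in> X" "t' \<noteq> q" "D p t q t'" using closer[of p t q] X pne dis ne by auto
  obtain s' where s': "s' \<in> X" "s' \<noteq> p" "D q s p s'" using closer[of q s p] X pne dis ne by auto
  have Dt: "D p t t' q" using D_swap_right t' X by blast
  have Ds: "D q s s' p" using D_swap_right s' X by blast
  have D': "D q t s p" using D X by (meson D_swap_left D_swap_right D_swap_sides)
  have qp: "(q \<in> P) \<noteq> (p \<in> P)" using pq by blast
  have far: "r \<in> X \<Longrightarrow> r \<noteq> q \<Longrightarrow> D p t r q \<Longrightarrow> \<not> (r \<in> P \<longleftrightarrow> t \<in> P)" for r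
    using has_middle_if_repeated_colour[OF hom pq X(1-4) _ D _ ne] none by blast
  have tcol: "\<not> (t' \<in> P \<longleftrightarrow> t \<in> P)" using far t' Dt by blast
  have scol: "\<not> (s' \<in> P \<longleftrightarrow> s \<in> P)"
  proof
    assume "s' \<in> P \<longleftrightarrow> s \<in> P"
    then have "has_middle q t s p"
      using has_middle_if_repeated_colour[OF hom qp X(2,1,4,3) s'(1) D' Ds ne(2,1) s'(2)] by blast
    moreover have "has_middle p s t q" if mid: "has_middle q t s p"
    proof -
      obtain v where "v \<in> X" "D v t s p" "D q v s p" "D q t v p" "D q t s v"
        using mid unfolding has_middle_def by blast
      then have "v \<in> X" "D v s t q" "D p v t q" "D p s v q" "D p s t v"
        using X by (meson D_swap_left D_swap_right D_swap_sides)+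
      then show ?thesis unfolding has_middle_def by blast
    qed
    ultimately show False using none by blast
  qed
  \<comment> \<open>An automorphism over \<open>p, q\<close> taking \<open>x\<close> to
    \<open>t'\<close> carries \<open>r\<close> beyond \<open>t'\<close>, where no point of the
    colour of \<open>t\<close> is allowed. The pair \<open>x, r\<close> is \<open>s, t\<close> or
    \<open>s', s\<close>, depending on the colour of \<open>s\<close>.\<close>
  have move: False
    if x: "x \<in> X" "r \<in> X" "x \<notin> {p, q}" "t' \<in> P \<longleftrightarrow> x \<in> P" "D p x r q" "r \<noteq> q" "r \<in> P \<longleftrightarrow> t \<in> P" for x r
  proof -
    have t'': "t' \<notin> {p, q}" using t' D_disjoint[OF Dt] X by auto
    obtain g where g: "DP_iso D P X X g" "g p = p" "g q = q" "g x = t'"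
      using homogeneous_move_over_pair[OF hom X(1,2) pq x(1) t'(1) x(3) t'' x(4)] by blast
    note gf = automorphism_facts[OF g(1)]
    have gr: "g r \<in> X" "g r \<noteq> q" "g r \<in> P \<longleftrightarrow> t \<in> P"
      using gf(1)[of r] gf(2)[of r] gf(3)[of r q] g(3) that X by auto
    have "D p t' (g r) q" using gf(5)[of p x r q] g that X by auto
    then have "D p t (g r) q" using D_nest(1)[OF Dt] X t'(1) gr(1) by blast
    then show False using far gr by blast
  qed
  show False
  proof (cases "t' \<in> P \<longleftrightarrow> s \<in> P")
    case True
    then show False using move[of s t] X D ne dis by blast
  next
    case False
    have "D p s' s q" using Ds s' X by (meson D_swap_left D_swap_right D_swap_sides)
    moreover have "s' \<notin> {p, q}" using s' D_disjoint[OF Ds] X by auto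
    ultimately show False using move[of s' s] X s' False scol tcol dis by blast
  qed
qed

text \<open>A gap between two pairs divides all of \<open>X\<close> into two sides. Ends
  \<open>p, q\<close> of different colours are chosen on different sides, and the middle found on
  the path between them would belong to both.\<close>

lemma D_dense_if_homogeneous:
  assumes hom: "P_homogeneous X D P" and proper: "D_proper X D"
    and P: "P \<subseteq> X" "P \<noteq> {}" "P \<noteq> X"
  shows "D_dense X D"
proof -
  have closer: "\<exists>z\<in>X. z \<noteq> y \<and> D w x y z" if "w \<in> X" "x \<in> X" "y \<in> X" "distinct [w, x, y]" for w x y
    using proper that unfolding D_proper_def by auto
  have three: "infinite X \<or> 3 \<le> card X" using proper unfolding D_proper_def by blast
  have degenerate: "has_middle w w y z" if m: "w \<in> X" "y \<in> X" "z \<in> X" and D: "D w w y z" for w y z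
  proof -
    have dis: "w \<noteq> y" "w \<noteq> z" using D_disjoint[OF D] m by auto
    obtain v where v: "v \<in> X" "v \<noteq> w" "D v w y z"
    proof (cases "y = z")
      case True
      have "\<not> X \<subseteq> {w, y}"
      proof
        assume "X \<subseteq> {w, y}"
        then have "finite X" "card X \<le> card {w, y}" by (auto intro: finite_subset card_mono)
        then show False using three card_insert_le_m1[of 2 "{y}" w] by auto
      qed
      then obtain v where "v \<in> X" "v \<noteq> w" "v \<noteq> y" by blast
      then show ?thesis using that D_point[of v y w] m dis True by blast
    next
      case False
      then obtain v where "v \<in> X" "v \<noteq> w" "D y z w v" using closer[of y z w] m dis by auto
      then show ?thesis using that m by (meson D_swap_left D_swap_sides)
    qed
    have "v \<noteq> y" "v \<noteq> z" using D_disjoint[OF v(3)] m v by auto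
    then have "D w w v z" "D w w y v" "D w v y z"
      using D_point_left[of w v z] D_point_left[of w y v] D_swap_left[OF v(3)] m v dis by auto
    then show ?thesis unfolding has_middle_def using v by blast
  qed
  have "has_middle w x y z" if m: "w \<in> X" "x \<in> X" "y \<in> X" "z \<in> X" and D: "D w x y z" for w x y z
  proof (rule ccontr)
    assume none: "\<not> ?thesis"
    have wx: "w \<noteq> x" using none degenerate[of w y z] m D by blast
    have yz: "y \<noteq> z"
      using none degenerate[of y w x] has_middle_swap[of y z w x] m D_swap_sides[OF D m] by blast
    \<comment> \<open>A point on both sides of the gap would be a middle. With
      \<open>either\<close>, each point lies on exactly one side.\<close>
    have not_both: "\<not> (D v x y z \<and> D w x y v)" if v: "v \<in> X" for v
    proof
      assume both: "D v x y z \<and> D w x y v"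
      then have "D w v y z" using D_trans[of w x y z v] D D_swap_left m v by blast
      moreover have "D w x v z" using D_trans_right[of w x v y z] D both D_swap_right m v by blast
      ultimately show False using none both v unfolding has_middle_def by blast
    qed
    have either: "D v x y z \<or> D w x y v" if "v \<in> X" for v using D_either[OF D m that] .
    \<comment> \<open>If two points of different colours lie on the same side, one of them differs
      in colour from \<open>x\<close> or \<open>y\<close>, whichever is on the opposite
      side.\<close>
    obtain p q where pq: "p \<in> X" "q \<in> X" "(p \<in> P) \<noteq> (q \<in> P)" "D p x y z" "D w x y q"
    proof -
      obtain p0 q0 where p0: "p0 \<in> P" "p0 \<in> X" and q0: "q0 \<in> X" "q0 \<notin> P" using P by blast
      have ends: "D x x y z" "D w x y y"
        using D_point_left[of x y z] D_point[of w y x] D_disjoint[OF D m] m by auto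
      show ?thesis
      proof (cases "D p0 x y z"; cases "D q0 x y z")
        assume "D p0 x y z" "D q0 x y z"
        then show ?thesis using that[of p0 y] that[of q0 y] ends p0 q0 m by blast
      next
        assume "D p0 x y z" "\<not> D q0 x y z"
        then show ?thesis using that[of p0 q0] either[OF q0(1)] p0 q0 by blast
      next
        assume "\<not> D p0 x y z" "D q0 x y z"
        then show ?thesis using that[of q0 p0] either[OF p0(2)] p0 q0 by blast
      next
        assume "\<not> D p0 x y z" "\<not> D q0 x y z"
        then show ?thesis
          using that[of x p0] that[of x q0] either[OF p0(2)] either[OF q0(1)] ends p0 q0 m by blast
      qed
    qed
    have pne: "p \<noteq> q" "q \<noteq> p" using pq(3) by auto
    \<comment> \<open>The points \<open>s, t\<close> are the last branch of \<open>w, x\<close> and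
      the first branch of \<open>y, z\<close> on the path from \<open>p\<close> to \<open>q\<close>,
      so that a point between them is separated from either pair.\<close>
    obtain s where s: "s = w \<or> s = x" "s \<noteq> p" "\<And>v. v \<in> X \<Longrightarrow> D p s v q \<Longrightarrow> D w x v q"
      using exists_branch_at[OF wx pne(1) m(1,2) pq(1,2)] by blast
    obtain t where t: "t = y \<or> t = z" "t \<noteq> q" "\<And>v. v \<in> X \<Longrightarrow> D q t v p \<Longrightarrow> D y z v p"
      using exists_branch_at[OF yz pne(2) m(3,4) pq(2,1)] by blast
    have st: "s \<in> X" "t \<in> X" using s t m by auto
    have "D s x y z" using s(1) D D_point_left[of x y z] D_disjoint[OF D m] m by auto
    then have ps: "D p s y z" using D_trans[of p x y z s] D_swap_left pq st m by blast
    have nq: "\<not> D q s y z"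
    proof
      assume "D q s y z"
      then have "D q x y z" using D_trans[of q s y z x] \<open>D s x y z\<close> pq st m by blast
      then show False using not_both pq by blast
    qed
    have "D p s y q" using D_either[of p s y z q] ps nq pq st m by blast
    moreover have "D p s z q"
      using D_either[of p s z y q] ps nq D_swap_right pq st m by blast
    ultimately have "D p s t q" using t(1) by blast
    then obtain v where v: "v \<in> X" "D p v t q" "D p s v q"
      using has_middle_if_bicoloured_ends[OF hom proper pq(3,1,2) st _ s(2) t(2)]
      unfolding has_middle_def by blast
    have "D w x v q" using s(3) v by blast
    then have 1: "D w x y v" using D_trans_right[of w x y q v] pq(5) D_swap_right m pq(2) v(1) by blast
    have "D q t v p" using v pq st by (meson D_swap_left D_swap_right D_swap_sides)
    then have "D y z v p" using t(3) v by blast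
    then have "D v p y z" using D_swap_sides m v pq by blast
    then have "D v x y z" using D_trans[of v p y z x] pq m v by blast
    then show False using 1 not_both v by blast
  qed
  then show ?thesis using three unfolding D_dense_def has_middle_def by fastforce
qed

section \<open>Constant valency from homogeneity\<close>

lemma node_at_eqpoll_automorphic_image:
  assumes g: "DP_iso D P X X g" and PX: "P \<subseteq> X" and abc: "a \<in> P" "b \<in> P" "c \<in> P"
  shows "node_at P D a b c \<approx> node_at P D (g a) (g b) (g c)"
proof -
  note gf = automorphism_facts[OF g]
  have gP: "g ` P = P"
  proof
    show "g ` P \<subseteq> P" using gf(2) PX by blast
    show "P \<subseteq> g ` P"
    proof
      fix y assume "y \<in> P"
      then obtain u where "u \<in> X" "g u = y" using gf(4) PX by blast
      then show "y \<in> g ` P" using gf(2)[of u] \<open>y \<in> P\<close> by blast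
    qed
  qed
  have S_iff: "co_sector D (g a) (g b) (g c) (g u) (g v) \<longleftrightarrow> co_sector D a b c u v"
    if "u \<in> P" "v \<in> P" for u v
  proof -
    have X: "u \<in> X" "v \<in> X" "a \<in> X" "b \<in> X" "c \<in> X" using that abc PX by auto
    show ?thesis unfolding co_sector_def
      using gf(5)[OF X(1,2,3,4)] gf(5)[OF X(1,2,4,5)] gf(5)[OF X(1,2,3,5)] by blast
  qed
  have sector: "{v \<in> P. co_sector D (g a) (g b) (g c) (g u) v} = g ` {v \<in> P. co_sector D a b c u v}"
    if "u \<in> P" for u
  proof (intro set_eqI iffI)
    fix y assume y: "y \<in> {v \<in> P. co_sector D (g a) (g b) (g c) (g u) v}"
    then obtain v where "v \<in> P" "y = g v" using gP by blast
    then show "y \<in> g ` {v \<in> P. co_sector D a b c u v}" using S_iff[OF that] y by blast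
  next
    fix y assume "y \<in> g ` {v \<in> P. co_sector D a b c u v}"
    then obtain v where "v \<in> P" "y = g v" "co_sector D a b c u v" by blast
    then show "y \<in> {v \<in> P. co_sector D (g a) (g b) (g c) (g u) v}" using S_iff[OF that] gP by blast
  qed
  have "node_at P D (g a) (g b) (g c) = (\<lambda>u. {v \<in> P. co_sector D (g a) (g b) (g c) u v}) ` g ` P"
    unfolding node_at_def gP ..
  also have "\<dots> = (image g) ` node_at P D a b c"
    unfolding node_at_def image_image using sector by (intro image_cong) auto
  finally have eq: "node_at P D (g a) (g b) (g c) = (image g) ` node_at P D a b c" .
  have "inj_on g P" using gf(3) PX by (auto simp: inj_on_def)
  then have "inj_on (image g) (Pow P)" by (rule inj_on_image_Pow)
  then have "inj_on (image g) (node_at P D a b c)"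
    by (rule inj_on_subset) (auto simp: node_at_def)
  then show ?thesis unfolding eq by (simp add: inj_on_image_eqpoll_self eqpoll_sym)
qed

text \<open>Three points alone carry only degenerate relations, so the type of a triple over
  \<open>q\<close> merely records which of its members, if any, shares a sector with
  \<open>q\<close> at their median.\<close>

lemma homogeneous_move_triple:
  assumes hom: "P_homogeneous X D P" and PX: "P \<subseteq> X" and q: "q \<in> X - P"
    and a: "a1 \<in> P" "a2 \<in> P" "a3 \<in> P" "distinct [a1, a2, a3]"
    and b: "b1 \<in> P" "b2 \<in> P" "b3 \<in> P" "distinct [b1, b2, b3]"
    and D: "D a1 q a2 a3 \<longleftrightarrow> D b1 q b2 b3" "D a2 q a1 a3 \<longleftrightarrow> D b2 q b1 b3"
      "D a3 q a1 a2 \<longleftrightarrow> D b3 q b1 b2"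
  shows "\<exists>g. DP_iso D P X X g \<and> g a1 = b1 \<and> g a2 = b2 \<and> g a3 = b3"
proof -
  define f where "f x = (if x = a1 then b1 else if x = a2 then b2 else b3)" for x
  have f: "f a1 = b1" "f a2 = b2" "f a3 = b3" using a unfolding f_def by auto
  have X: "a1 \<in> X" "a2 \<in> X" "a3 \<in> X" "b1 \<in> X" "b2 \<in> X" "b3 \<in> X" "q \<in> X" using a b q PX by auto
  have bij: "bij_betw f {a1, a2, a3} {b1, b2, b3}"
    using f a b by (auto simp: bij_betw_def inj_on_def)
  have inj: "f u = f v \<longleftrightarrow> u = v" if "u \<in> {a1, a2, a3}" "v \<in> {a1, a2, a3}" for u v
    using bij that unfolding bij_betw_def by (meson inj_onD)
  have mem: "u \<in> X" "f u \<in> X" "u \<in> P" "f u \<in> P" if "u \<in> {a1, a2, a3}" for u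
    using that X a b f by auto
  have iso: "DP_iso D P {a1, a2, a3} {b1, b2, b3} f"
  proof -
    have pres: "D (f u) (f v) (f w) (f z) \<longleftrightarrow> D u v w z"
      if m: "u \<in> {a1, a2, a3}" "v \<in> {a1, a2, a3}" "w \<in> {a1, a2, a3}" "z \<in> {a1, a2, a3}" for u v w z
    proof -
      have "card (set [u, v, w, z]) \<le> card {a1, a2, a3}" using m by (intro card_mono) auto
      also have "\<dots> \<le> 3" by (simp add: card_insert_if)
      finally have le: "card (set [u, v, w, z]) \<le> 3" .
      have d: "\<not> distinct [u, v, w, z]"
      proof
        assume "distinct [u, v, w, z]"
        from le[unfolded distinct_card[OF this]] show False by simp
      qed
      then have d': "\<not> distinct [f u, f v, f w, f z]" by auto
      show ?thesis
        using D_degenerate_iff[OF d mem(1)[OF m(1)] mem(1)[OF m(2)] mem(1)[OF m(3)] mem(1)[OF m(4)]]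
          D_degenerate_iff[OF d' mem(2)[OF m(1)] mem(2)[OF m(2)] mem(2)[OF m(3)] mem(2)[OF m(4)]]
          inj[OF m(1,3)] inj[OF m(1,4)] inj[OF m(2,3)] inj[OF m(2,4)] by blast
    qed
    have col: "f u \<in> P \<longleftrightarrow> u \<in> P" if "u \<in> {a1, a2, a3}" for u
      using mem(3,4)[OF that] by simp
    show ?thesis unfolding DP_iso_def by (intro conjI ballI bij pres col)
  qed
  have "DP_iso D P (insert q {a1, a2, a3}) (insert q {b1, b2, b3}) (f(q := q))"
  proof (rule DP_iso_insert[OF iso])
    fix u v w assume m: "u \<in> {a1, a2, a3}" "v \<in> {a1, a2, a3}" "w \<in> {a1, a2, a3}"
    show "D (f u) (f v) q (f w) \<longleftrightarrow> D u v q w"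
    proof (cases "distinct [u, v, w]")
      case False
      have qn: "q \<noteq> u" "q \<noteq> v" "q \<noteq> w" "f u \<noteq> q" "f v \<noteq> q" "f w \<noteq> q"
        using mem(3,4)[OF m(1)] mem(3,4)[OF m(2)] mem(3,4)[OF m(3)] q by auto
      have d: "\<not> distinct [u, v, q, w]" using False by auto
      then have d': "\<not> distinct [f u, f v, q, f w]" using qn by auto
      show ?thesis
        using D_degenerate_iff[OF d mem(1)[OF m(1)] mem(1)[OF m(2)] X(7) mem(1)[OF m(3)]]
          D_degenerate_iff[OF d' mem(2)[OF m(1)] mem(2)[OF m(2)] X(7) mem(2)[OF m(3)]]
          inj[OF m(1,3)] inj[OF m(2,3)] qn by auto
    next
      case True
      have rot: "D x y q z \<longleftrightarrow> D z q x y" "D y x q z \<longleftrightarrow> D z q x y"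
        if "x \<in> X" "y \<in> X" "z \<in> X" for x y z
        using that X(7) by (meson D_swap_left D_swap_right D_swap_sides)+
      note rots = rot[OF X(1,2,3)] rot[OF X(1,3,2)] rot[OF X(2,3,1)]
        rot[OF X(4,5,6)] rot[OF X(4,6,5)] rot[OF X(5,6,4)]
      consider "u = a1 \<and> v = a2 \<and> w = a3 \<or> u = a2 \<and> v = a1 \<and> w = a3"
        | "u = a1 \<and> v = a3 \<and> w = a2 \<or> u = a3 \<and> v = a1 \<and> w = a2"
        | "u = a2 \<and> v = a3 \<and> w = a1 \<or> u = a3 \<and> v = a2 \<and> w = a1"
        using m True by auto
      then show ?thesis
      proof cases
        case 1 then show ?thesis using f rots D by auto
      next
        case 2 then show ?thesis using f rots D by auto
      next
        case 3 then show ?thesis using f rots D by auto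
      qed
    qed
  qed (use a b q PX in auto)
  moreover have "insert q {a1, a2, a3} \<subseteq> X" "insert q {b1, b2, b3} \<subseteq> X" using X by auto
  moreover have "insert q {a1, a2, a3} \<inter> P \<noteq> {}" "insert q {a1, a2, a3} - P \<noteq> {}"
    "insert q {b1, b2, b3} \<inter> P \<noteq> {}" "insert q {b1, b2, b3} - P \<noteq> {}" using a b q by auto
  ultimately obtain g where g: "DP_iso D P X X g" "\<forall>x\<in>insert q {a1, a2, a3}. g x = (f(q := q)) x"
    using hom unfolding P_homogeneous_def by (meson finite.emptyI finite_insert)
  have "g x = f x" if "x \<in> {a1, a2, a3}" for x using g(2) that a q by auto
  then show ?thesis using g(1) f by auto
qed

lemma same_node_valency_if_homogeneous:
  assumes hom: "P_homogeneous X D P" and PX: "P \<subseteq> X" "P \<noteq> X"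
  shows "same_node_valency P D"
proof -
  obtain q where q: "q \<in> X - P" using PX by blast
  interpret Q: D_structure P D by (rule D_structure_subset[OF PX(1)])
  \<comment> \<open>In the good case the triple can be chosen with \<open>q\<close> in the sector of
    its first member, so any two good nodes are matched by an automorphism. Otherwise
    \<open>q\<close> hangs from the node itself.\<close>
  define good where "good S \<longleftrightarrow> (\<exists>A\<in>S. \<exists>B\<in>S. \<exists>C\<in>S. \<exists>a\<in>A. \<exists>b\<in>B. \<exists>c\<in>C. distinct [A, B, C] \<and> D a q b c)" for S
  have common: "S \<approx> T"
    if S: "node_splitting P D S" and T: "node_splitting P D T"
      and sA: "A1 \<in> S" "A2 \<in> S" "A3 \<in> S" "distinct [A1, A2, A3]" "a1 \<in> A1" "a2 \<in> A2" "a3 \<in> A3"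
      and sB: "B1 \<in> T" "B2 \<in> T" "B3 \<in> T" "distinct [B1, B2, B3]" "b1 \<in> B1" "b2 \<in> B2" "b3 \<in> B3"
      and D: "D a1 q a2 a3 \<longleftrightarrow> D b1 q b2 b3" "D a2 q a1 a3 \<longleftrightarrow> D b2 q b1 b3"
        "D a3 q a1 a2 \<longleftrightarrow> D b3 q b1 b2"
    for S T A1 A2 A3 a1 a2 a3 B1 B2 B3 b1 b2 b3
  proof -
    have sp: "splitting P D S" "splitting P D T" using S T unfolding node_splitting_def by auto
    note nS = Q.node_splitting_eq_node_at[OF sp(1) sA]
    note nT = Q.node_splitting_eq_node_at[OF sp(2) sB]
    interpret U: D_triple P D a1 a2 a3 by (rule nS(2))
    interpret V: D_triple P D b1 b2 b3 by (rule nT(2))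
    obtain g where g: "DP_iso D P X X g" "g a1 = b1" "g a2 = b2" "g a3 = b3"
      using homogeneous_move_triple[OF hom PX(1) q U.in_X _ V.in_X _ D]
        U.triple_distinct V.triple_distinct by auto
    show ?thesis
      using node_at_eqpoll_automorphic_image[OF g(1) PX(1) U.in_X] g(2-) nS(1) nT(1) by simp
  qed
  have singletons: "\<Sigma> = {b}"
    if T: "node_splitting P D T" and bad: "\<not> good T" and \<Sigma>: "\<Sigma> \<in> T" "b \<in> \<Sigma>" for T \<Sigma> b
  proof (rule ccontr)
    assume "\<Sigma> \<noteq> {b}"
    then obtain b' where b': "b' \<in> \<Sigma>" "b' \<noteq> b" using \<Sigma> by blast
    have sp: "splitting P D T" using T unfolding node_splitting_def by auto
    obtain A B C a0 b0 c0 where ABC: "A \<in> T" "B \<in> T" "C \<in> T" "distinct [A, B, C]" "a0 \<in> A" "b0 \<in> B" "c0 \<in> C"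
      by (rule Q.node_splitting_obtains[OF T])
    have "\<exists>U\<in>T. \<exists>V\<in>T. \<exists>u\<in>U. \<exists>v\<in>V. distinct [\<Sigma>, U, V]"
      using ABC by (metis distinct_length_2_or_more distinct_singleton)
    then obtain U V c d where UV: "U \<in> T" "V \<in> T" "c \<in> U" "d \<in> V" "distinct [\<Sigma>, U, V]" by blast
    have UVn: "\<Sigma> \<noteq> U" "U \<noteq> \<Sigma>" "\<Sigma> \<noteq> V" "V \<noteq> \<Sigma>" "U \<noteq> V" "V \<noteq> U" using UV(5) by auto
    have nD: "\<not> D u q v w"
      if "u \<in> E" "v \<in> F" "w \<in> G" "E \<in> T" "F \<in> T" "G \<in> T" "distinct [E, F, G]" for u v w E F G
      using bad that unfolding good_def by blast
    have mP: "b \<in> P" "b' \<in> P" "c \<in> P" "d \<in> P" using \<Sigma> b' UV Q.splitting_subset[OF sp] by auto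
    have mX: "b \<in> X" "b' \<in> X" "c \<in> X" "d \<in> X" "q \<in> X" using mP q PX by auto
    \<comment> \<open>Badness speaks of points in three different sectors. If \<open>e\<close>
      shares the sector of \<open>b\<close> or \<open>c\<close>, \<open>D_either\<close> with the
      point \<open>d\<close> of a third sector reduces to that situation.\<close>
    have no: "\<not> D e q b c" if e: "e \<in> P" for e
    proof
      assume De: "D e q b c"
      have eX: "e \<in> X" using e PX by blast
      obtain E where E: "E \<in> T" "e \<in> E" using Q.splitting_sectors_cases[OF sp e] by blast
      have De': "D e q c b" using De D_swap_right eX mX by blast
      consider "E = \<Sigma>" | "E = U" | "E \<noteq> \<Sigma>" "E \<noteq> U" by blast
      then show False
      proof cases
        case 1
        then have "\<not> D e q c d" "\<not> D d q c b"
          using nD[of e \<Sigma> c U d V] nD[of d V c U b \<Sigma>] UV(1-4) UVn \<Sigma> E by simp_all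
        then show False using D_either[OF De' eX mX(5,3,1,4)] by blast
      next
        case 2
        then have "\<not> D e q b d" "\<not> D d q b c"
          using nD[of e U b \<Sigma> d V] nD[of d V b \<Sigma> c U] UV(1-4) UVn \<Sigma> E by simp_all
        then show False using D_either[OF De eX mX(5,1,3,4)] by blast
      next
        case 3
        then show False using nD[of e E b \<Sigma> c U] De UV(1-4) UVn \<Sigma> E by simp
      qed
    qed
    have "b \<noteq> c" "b' \<noteq> c"
      using Q.splitting_sector_unique[OF sp \<Sigma>(1) UV(1)] \<Sigma> b' UV by auto
    moreover have "b \<in> P" "q \<notin> P" using mP q by auto
    \<comment> \<open>The statement \<open>no\<close> quantifies over all of \<open>P\<close>, so it
      survives the automorphism that replaces the pair \<open>b, c\<close> by \<open>b, b'\<close>.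
      But \<open>c\<close> would be a counterexample for the new pair.\<close>
    ultimately obtain g where g: "DP_iso D P X X g" "g b = b" "g q = q" "g c = b'"
      using homogeneous_move_over_pair[OF hom mX(1,5), of c b'] mX mP b' by auto
    note gf = automorphism_facts[OF g(1)]
    obtain e where e: "e \<in> X" "g e = c" using gf(4) mX by blast
    have "e \<in> P" using gf(2)[OF e(1)] e mP by blast
    then have nb: "\<not> D c q b b'" using no gf(5)[OF e(1) mX(5,1,3)] e g by auto
    have "D b b' c d"
      using Q.splitting_inside[OF sp \<Sigma>(1,2) b'(1), of c d] UV mP
        Q.splitting_sector_unique[OF sp \<Sigma>(1)] by auto
    then have "D q b' c d \<or> D b b' c q" using D_either mX by blast
    moreover have "\<not> D b' q c d" using nD[of b' \<Sigma> c U d V] b' \<Sigma> UV(1-4) UVn by simp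
    ultimately show False using nb mX by (meson D_swap_left D_swap_sides)
  qed
  \<comment> \<open>With one-point sectors in \<open>T\<close>, no four distinct points of
    \<open>P\<close> are related by \<open>D\<close>. A sector of \<open>S\<close> with two points
    would produce such a quadruple, so \<open>S\<close> also consists of points.\<close>
  have mixed: "S = T" if S: "node_splitting P D S" and T: "node_splitting P D T" and bad: "\<not> good T" for S T
  proof -
    have sp: "splitting P D S" "splitting P D T" using S T unfolding node_splitting_def by auto
    have singleS: "\<Sigma> = {a}" if \<Sigma>: "\<Sigma> \<in> S" "a \<in> \<Sigma>" for \<Sigma> a
    proof (rule ccontr)
      assume "\<Sigma> \<noteq> {a}"
      then obtain a' where a': "a' \<in> \<Sigma>" "a' \<noteq> a" using \<Sigma> by blast
      obtain A B C a0 b0 c0 where ABC: "A \<in> S" "B \<in> S" "C \<in> S" "distinct [A, B, C]" "a0 \<in> A" "b0 \<in> B" "c0 \<in> C"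
        by (rule Q.node_splitting_obtains[OF S])
      have "\<exists>U\<in>S. \<exists>V\<in>S. \<exists>u\<in>U. \<exists>v\<in>V. distinct [\<Sigma>, U, V]"
        using ABC by (metis distinct_length_2_or_more distinct_singleton)
      then obtain U V c d where UV: "U \<in> S" "V \<in> S" "c \<in> U" "d \<in> V" "distinct [\<Sigma>, U, V]" by blast
      note uniq = Q.splitting_sector_unique[OF sp(1)]
      have mP: "a \<in> P" "a' \<in> P" "c \<in> P" "d \<in> P" using \<Sigma> a' UV Q.splitting_subset[OF sp(1)] by auto
      have D: "D a a' c d"
        using Q.splitting_inside[OF sp(1) \<Sigma> a'(1), of c d] UV mP uniq[OF \<Sigma>(1)] by auto
      have "distinct [a, a', c, d]" using a' UV uniq \<Sigma> by auto
      moreover have "{r} \<in> T" if "r \<in> P" for r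
        using Q.splitting_sectors_cases[OF sp(2) that] singletons[OF T bad] by metis
      ultimately show False
        using Q.splitting_across[OF sp(2), of "{a}" "{a'}" "{c}" "{d}" a a' c d] D mP by auto
    qed
    have all: "R = (\<lambda>r. {r}) ` P" if R: "splitting P D R" and single: "\<And>\<Sigma> a. \<Sigma> \<in> R \<Longrightarrow> a \<in> \<Sigma> \<Longrightarrow> \<Sigma> = {a}" for R
    proof (intro set_eqI iffI)
      fix \<Sigma> assume s: "\<Sigma> \<in> R"
      then obtain a where "a \<in> \<Sigma>" using Q.splitting_partition[OF R] unfolding partition_on_def by fastforce
      then show "\<Sigma> \<in> (\<lambda>r. {r}) ` P" using single[OF s] Q.splitting_subset[OF R s] by blast
    next
      fix \<Sigma> assume "\<Sigma> \<in> (\<lambda>r. {r}) ` P"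
      then obtain r where r: "r \<in> P" "\<Sigma> = {r}" by blast
      then show "\<Sigma> \<in> R" using Q.splitting_sectors_cases[OF R r(1)] single by metis
    qed
    show ?thesis using all[OF sp(1) singleS] all[OF sp(2) singletons[OF T bad]] by simp
  qed
  show ?thesis
    unfolding same_node_valency_def
  proof (intro allI impI, elim conjE)
    fix S T assume S: "node_splitting P D S" and T: "node_splitting P D T"
    have sp: "splitting P D S" "splitting P D T" using S T unfolding node_splitting_def by auto
    consider "good S" "good T" | "\<not> good T" | "\<not> good S" by blast
    then show "S \<approx> T"
    proof cases
      case 1
      obtain A1 A2 A3 a1 a2 a3 where a: "A1 \<in> S" "A2 \<in> S" "A3 \<in> S" "distinct [A1, A2, A3]"
        "a1 \<in> A1" "a2 \<in> A2" "a3 \<in> A3" "D a1 q a2 a3" using 1(1) unfolding good_def by blast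
      obtain B1 B2 B3 b1 b2 b3 where b: "B1 \<in> T" "B2 \<in> T" "B3 \<in> T" "distinct [B1, B2, B3]"
        "b1 \<in> B1" "b2 \<in> B2" "b3 \<in> B3" "D b1 q b2 b3" using 1(2) unfolding good_def by blast
      have "a1 \<in> X" "a2 \<in> X" "a3 \<in> X" "b1 \<in> X" "b2 \<in> X" "b3 \<in> X" "q \<in> X"
        using a b q PX Q.splitting_subset[OF sp(1)] Q.splitting_subset[OF sp(2)] by blast+
      then have "\<not> D a2 q a1 a3" "\<not> D a3 q a1 a2" "\<not> D b2 q b1 b3" "\<not> D b3 q b1 b2"
        using a(8) b(8) by (meson D_excl D_swap_left D_swap_right D_swap_sides)+
      then show ?thesis using common[OF S T a(1-7) b(1-7)] a(8) b(8) by blast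
    next
      case 2 then show ?thesis using mixed[OF S T] by simp
    next
      case 3 then show ?thesis using mixed[OF T S] by simp
    qed
  qed
qed

section \<open>Pure sectors and the edge splitting\<close>

text \<open>With \<open>a\<close> and \<open>q\<close> fixed, \<open>b\<close> can be moved to a
  second point \<open>a'\<close> of \<open>A\<close>. No point of \<open>P\<close> is separated
  together with \<open>q\<close> from \<open>a, b\<close>, as it would lie in \<open>C\<close>; yet
  \<open>b\<close> is so separated from \<open>a, a'\<close>.\<close>

lemma no_node_with_two_pure_sectors:
  assumes hom: "P_homogeneous X D P" and proper: "D_proper X D" and PX: "P \<subseteq> X"
    and T: "node_splitting X D T" and sec: "A \<in> T" "B \<in> T" "C \<in> T" "A \<noteq> B"
    and sub: "A \<subseteq> P" "B \<subseteq> P" "C \<subseteq> X - P"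
  shows False
proof -
  have sp: "splitting X D T" using T unfolding node_splitting_def by blast
  note uniq = splitting_sector_unique[OF sp]
  have ne: "\<Sigma> \<noteq> {}" if "\<Sigma> \<in> T" for \<Sigma>
    using splitting_partition[OF sp] that unfolding partition_on_def by blast
  obtain a b q where abq: "a \<in> A" "b \<in> B" "q \<in> C"
    using ne[OF sec(1)] ne[OF sec(2)] ne[OF sec(3)] by blast
  have X: "a \<in> X" "b \<in> X" "q \<in> X" using abq sub PX by auto
  have P: "a \<in> P" "b \<in> P" "q \<notin> P" using abq sub by auto
  have dis: "A \<noteq> C" "B \<noteq> C" "a \<noteq> b" "distinct [b, q, a]" using abq P uniq[OF sec(1,2)] sec(4) sub by auto
  have "\<not> {u \<in> X. D u a b q} \<subseteq> {a}"
    using infinite_cone[OF proper X(2,3,1) dis(4)] finite_subset by blast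
  then obtain a' where a': "a' \<in> X" "a' \<noteq> a" "D a' a b q" by blast
  have "\<exists>\<Sigma>\<in>T. a' \<in> \<Sigma> \<and> a \<in> \<Sigma>"
    by (rule splitting_separates[OF sp sec(2,3) dis(2) abq(2,3) a'(3,1) X(1)])
  then have a'A: "a' \<in> A" using uniq sec(1) abq(1) by blast
  have no: "\<not> D e q a b" if e: "e \<in> P" for e
  proof
    assume D: "D e q a b"
    have eX: "e \<in> X" using e PX by blast
    have "\<exists>\<Sigma>\<in>T. e \<in> \<Sigma> \<and> q \<in> \<Sigma>"
      by (rule splitting_separates[OF sp sec(1,2,4) abq(1,2) D eX X(3)])
    then have "e \<in> C" using uniq sec(3) abq(3) by blast
    then show False using sub e by blast
  qed
  have "b \<notin> {a, q}" "a' \<notin> {a, q}" "a' \<in> P \<longleftrightarrow> b \<in> P" "(a \<in> P) \<noteq> (q \<in> P)"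
    using dis P a' a'A sub by auto
  then obtain g where g: "DP_iso D P X X g" "g a = a" "g q = q" "g b = a'"
    using homogeneous_move_over_pair[OF hom X(1,3) _ X(2) a'(1)] by blast
  note gf = automorphism_facts[OF g(1)]
  obtain e where e: "e \<in> X" "g e = b" using gf(4) X by blast
  have "e \<in> P" using gf(2)[OF e(1)] e P by blast
  then have "\<not> D b q a a'" using no gf(5)[OF e(1) X(3,1,2)] e g by auto
  then show False using a' X by (meson D_swap_left D_swap_sides)
qed

lemma true_edge_splitting_if_pure_sector:
  assumes hom: "P_homogeneous X D P" and proper: "D_proper X D" and PX: "P \<subseteq> X" "P \<noteq> X"
    and S: "splitting X D S" "\<Sigma> \<in> S" "infinite \<Sigma>" "\<Sigma> \<subseteq> P"
    and card: "card P \<noteq> 1" "card (X - P) \<noteq> 1"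
  shows "true_edge_splitting X D {P, X - P}"
proof -
  obtain q where q: "q \<in> X - P" using PX by blast
  obtain a where a: "a \<in> \<Sigma>" using S(3) by fastforce
  have "\<not> \<Sigma> \<subseteq> {a}" using S(3) finite_subset by blast
  then obtain b where b: "b \<in> \<Sigma>" "b \<noteq> a" by blast
  have P: "a \<in> P" "b \<in> P" "q \<notin> P" using a b q S(4) by auto
  have X: "a \<in> X" "b \<in> X" "q \<in> X" using P PX q by auto
  \<comment> \<open>All of \<open>X - P\<close> lies outside the sector and is thus separated from
    \<open>a, b\<close>. The automorphism fixing \<open>a, q\<close> and taking \<open>b\<close> to
    \<open>c\<close> permutes \<open>X - P\<close>, so the same holds for
    \<open>a, c\<close>.\<close>
  have base: "D a c y q" if c: "c \<in> P" and y: "y \<in> X - P" for c y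
  proof (cases "c = a")
    case True
    then show ?thesis using D_point_left[of a y q] X P y by auto
  next
    case False
    have cX: "c \<in> X" using c PX by blast
    have "b \<notin> {a, q}" "c \<notin> {a, q}" "c \<in> P \<longleftrightarrow> b \<in> P" "(a \<in> P) \<noteq> (q \<in> P)"
      using False P b c by auto
    then obtain g where g: "DP_iso D P X X g" "g a = a" "g q = q" "g b = c"
      using homogeneous_move_over_pair[OF hom X(1,3) _ X(2) cX] by blast
    note gf = automorphism_facts[OF g(1)]
    obtain e where e: "e \<in> X" "g e = y" using gf(4) y by blast
    have "e \<notin> P" using gf(2)[OF e(1)] e y by blast
    then have "D a b e q" using splitting_inside[OF S(1,2) a b(1), of e q] e q S(4) by blast
    then show ?thesis using gf(5)[OF X(1,2) e(1) X(3)] e g by auto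
  qed
  have sep: "D c c' y y'" if "c \<in> P" "c' \<in> P" "y \<in> X - P" "y' \<in> X - P" for c c' y y'
  proof -
    have mX: "c \<in> X" "c' \<in> X" "y \<in> X" "y' \<in> X" using that PX by auto
    have "D c c' z q" if z: "z \<in> X - P" for z
      using D_trans[of c a z q c'] base[OF \<open>c \<in> P\<close> z] base[OF \<open>c' \<in> P\<close> z] D_swap_left X mX z by blast
    then show ?thesis using that(3,4) D_trans_right[of c c' y q y'] D_swap_right X mX by blast
  qed
  have sep': "D y y' c c'" if "c \<in> P" "c' \<in> P" "y \<in> X - P" "y' \<in> X - P" for c c' y y'
    using sep[OF that] that PX D_swap_sides by blast
  have ne: "P \<noteq> X - P" "P \<noteq> {}" "X - P \<noteq> {}" using P q by auto
  have part: "partition_on X {P, X - P}"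
    using ne PX by (intro partition_onI) (auto simp: disjnt_def)
  have two: "card {P, X - P} = 2" using ne by simp
  have split: "splitting X D {P, X - P}"
    unfolding splitting_def
  proof (intro conjI ballI impI)
    show "partition_on X {P, X - P}" by (rule part)
    show "infinite {P, X - P} \<or> 2 \<le> card {P, X - P}" using two by simp
  next
    fix \<Sigma>' c c' y y' assume "\<Sigma>' \<in> {P, X - P}" "c \<in> \<Sigma>'" "c' \<in> \<Sigma>'" "y \<in> X - \<Sigma>'" "y' \<in> X - \<Sigma>'"
    then show "D c c' y y'" using sep[of c c' y y'] sep'[of y y' c c'] PX by blast
  next
    fix A B C E a b c d
    assume "A \<in> {P, X - P}" "B \<in> {P, X - P}" "C \<in> {P, X - P}" "distinct [A, B, C, E]"
    then show "\<not> D a b c d" by auto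
  qed
  \<comment> \<open>Two of three pure sectors lie on the same side, while the sector through
    \<open>q\<close> or \<open>a\<close> lies on the other. The case of two sectors outside
    \<open>P\<close> is handled with the colours exchanged.\<close>
  have no_node: False if T: "node_splitting X D T" and ref: "refines X T {P, X - P}" for T
  proof -
    have sp: "splitting X D T" using T unfolding node_splitting_def by blast
    have pure: "\<Sigma>' \<subseteq> P \<or> \<Sigma>' \<subseteq> X - P" if "\<Sigma>' \<in> T" for \<Sigma>'
      using ref that unfolding refines_def by auto
    obtain A B C a0 b0 c0 where ABC: "A \<in> T" "B \<in> T" "C \<in> T" "distinct [A, B, C]"
      by (rule node_splitting_obtains[OF T])
    obtain E where E: "E \<in> T" "q \<in> E" using splitting_sectors_cases[OF sp X(3)] by blast
    obtain F where F: "F \<in> T" "a \<in> F" using splitting_sectors_cases[OF sp X(1)] by blast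
    have EF: "E \<subseteq> X - P" "F \<subseteq> P" using pure[OF E(1)] pure[OF F(1)] E F P by auto
    have PP: "X - (X - P) = P" using PX by blast
    have inP: False if "U \<in> T" "V \<in> T" "U \<noteq> V" "U \<subseteq> P" "V \<subseteq> P" for U V
      using no_node_with_two_pure_sectors[OF hom proper PX(1) T that(1,2) E(1) that(3-5) EF(1)] .
    have inQ: False if "U \<in> T" "V \<in> T" "U \<noteq> V" "U \<subseteq> X - P" "V \<subseteq> X - P" for U V
      using no_node_with_two_pure_sectors[OF P_homogeneous_Compl[OF hom PX(1)] proper Diff_subset T
          that(1,2) F(1) that(3-5)] EF(2) unfolding PP by blast
    show False using pure[OF ABC(1)] pure[OF ABC(2)] pure[OF ABC(3)] ABC(4) inP inQ ABC(1-3) by auto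
  qed
  have "\<not> is_singleton F" if "F = P \<or> F = X - P" for F
    using that card by (auto simp: is_singleton_altdef)
  then show ?thesis
    unfolding true_edge_splitting_def edge_splitting_def using split two no_node by blast
qed

end

section \<open>The characterisation of homogeneity\<close>

theorem mainTheorem13:
  fixes \<Omega> :: "'a set"
    and D :: "'a \<Rightarrow> 'a \<Rightarrow> 'a \<Rightarrow> 'a \<Rightarrow> bool"
    and P :: "'a set"
  assumes "D_set \<Omega> D"
    and "D_proper \<Omega> D"
    and "countable \<Omega>"
    and "P \<subseteq> \<Omega>"
    and "P \<noteq> {}"
    and "P \<noteq> \<Omega>"
  shows "P_homogeneous \<Omega> D P \<longleftrightarrow>
    D_dense \<Omega> D \<and>
    (same_node_valency P D \<and> same_node_valency (\<Omega> - P) D) \<and>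
    ((\<forall>S \<Sigma>. splitting \<Omega> D S \<and> \<Sigma> \<in> S \<and> infinite \<Sigma> \<longrightarrow> \<Sigma> \<inter> P \<noteq> {} \<and> \<Sigma> - P \<noteq> {}) \<or>
     true_edge_splitting \<Omega> D {P, \<Omega> - P} \<or>
     (card P = 1 \<or> card (\<Omega> - P) = 1))"
    (is "_ \<longleftrightarrow> ?dense \<and> ?valency \<and> (?mixed \<or> ?edge \<or> ?single)")
proof -
  interpret D_structure \<Omega> D by unfold_locales (rule assms(1))
  have PP: "\<Omega> - (\<Omega> - P) = P" using assms(4) by blast
  have QX: "\<Omega> - P \<subseteq> \<Omega>" "\<Omega> - P \<noteq> {}" "\<Omega> - P \<noteq> \<Omega>" using assms(4-6) by auto
  show ?thesis
  proof
    assume hom: "P_homogeneous \<Omega> D P"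
    note hom' = P_homogeneous_Compl[OF hom assms(4)]
    have dense: ?dense by (rule D_dense_if_homogeneous[OF hom assms(2,4-6)])
    have val: ?valency
      using same_node_valency_if_homogeneous[OF hom assms(4,6)]
        same_node_valency_if_homogeneous[OF hom' QX(1,3)] by blast
    \<comment> \<open>Failure of the first alternative yields an infinite sector of a single colour.
      If that colour is the complement, the colours are exchanged; the edge splitting is symmetric
      in its two sides.\<close>
    have "?edge" if "\<not> ?mixed" "\<not> ?single"
    proof -
      have card: "card P \<noteq> 1" "card (\<Omega> - P) \<noteq> 1" using that(2) by auto
      obtain S \<Sigma> where S: "splitting \<Omega> D S" "\<Sigma> \<in> S" "infinite \<Sigma>" and pure: "\<Sigma> \<inter> P = {} \<or> \<Sigma> - P = {}"
        using \<open>\<not> ?mixed\<close> by blast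
      from pure show ?thesis
      proof
        assume "\<Sigma> - P = {}"
        then show ?thesis using true_edge_splitting_if_pure_sector[OF hom assms(2,4,6) S _ card] by blast
      next
        assume "\<Sigma> \<inter> P = {}"
        then have "\<Sigma> \<subseteq> \<Omega> - P" using splitting_subset[OF S(1,2)] by blast
        then have "true_edge_splitting \<Omega> D {\<Omega> - P, \<Omega> - (\<Omega> - P)}"
          using true_edge_splitting_if_pure_sector[OF hom' assms(2) QX(1,3) S] card PP by simp
        then show ?thesis unfolding PP by (simp add: insert_commute)
      qed
    qed
    then show "?dense \<and> ?valency \<and> (?mixed \<or> ?edge \<or> ?single)" using dense val by blast
  next
    assume "?dense \<and> ?valency \<and> (?mixed \<or> ?edge \<or> ?single)"
    then have dense: ?dense and val: "same_node_valency P D" "same_node_valency (\<Omega> - P) D"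
      and cases: "?mixed \<or> ?edge \<or> ?single" by auto
    consider ?mixed | ?edge | "card P = 1" | "card (\<Omega> - P) = 1" using cases by blast
    then show "P_homogeneous \<Omega> D P"
    proof cases
      case 1
      then show ?thesis
        using P_homogeneous_if_sectors_bicoloured[OF assms(2-4) dense val(1)] by blast
    next
      case 2
      then show ?thesis
        using P_homogeneous_if_true_edge_splitting[OF assms(3) dense assms(4) val] by blast
    next
      case 3
      then obtain p where p: "P = {p}" using card_1_singletonE by blast
      then show ?thesis
        using P_homogeneous_if_singleton[OF assms(2,3) dense] val(2) assms(4) by auto
    next
      case 4
      then obtain q where q: "\<Omega> - P = {q}" using card_1_singletonE by blast
      then have Pq: "P = \<Omega> - {q}" "q \<in> \<Omega>" using PP by auto
      then have "P_homogeneous \<Omega> D {q}"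
        using P_homogeneous_if_singleton[OF assms(2,3) dense] val(1) by auto
      then show ?thesis using P_homogeneous_Compl[of \<Omega> D "{q}"] Pq by auto
    qed
  qed
qed

end
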